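(* Let $(\Omega,\mathcal F,\mathsf P)$ be a probability space and let $(X_n)_{n\in\mathbb N}$ be a sequence of i.i.d. random variables on it with $\mathsf E_{\mathsf P}[X_1]=0$ and $\mathsf E_{\mathsf P}|X_1|^q<\infty$, where $q\in[1,2)$. Let $S_n:=\sum_{i=1}^nX_i$, $\mathsf U^{(q)}_{\mathsf P}(x):=\mathsf E_{\mathsf P}[|X_1|^q\mathbf 1\{|X_1|^q\ge x\}]$ for $x\ge0$, and let $(\mathcal F_n)_{n\in\mathbb N_0}$ be the filtration generated by $(X_n)_{n\in\mathbb N}$. For $j\in\mathbb N$ set $$m_j:=\min\left\{m\in\mathbb N:\frac{4\exp(-m^{1/q-1/2})}{2-q}+\frac{451\,q\,j^2}{2-q}\,\mathsf U^{(q)}_{\mathsf P}\left(\frac{m^{1/2-q/4}}{38j^q}\right)\le2^{-j}\right\},$$ and for $n\in\mathbb N_0$ define $$E_n^{(q)}:=\sum_{j\in\mathbb N}\mathbf 1\left\{\text{there exists }k\in\{m_j,\ldots,n\}\text{ such that }\frac{|S_k|}{k^{1/q}}\ge\frac1j\right\}.$$ Then $(E_n^{(q)})_{n\in\mathbb N_0}$ is a $\mathsf P$-$e$-process, and $E_n^{(q)}(\omega)\to\infty$ as $n\to\infty$ for every $\omega\in A_{q\text{-div}}:=\{S_n/n^{1/q}\text{ does not converge to }0\}$.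
   Context: $\mathbb N=\{1,2,\dots\}$, $\mathbb N_0=\{0,1,2,\dots\}$; $\{a,\dots,b\}$ is empty if $a>b$. $e$-process: a nonnegative $(\mathcal F_n)_{n\in\mathbb N_0}$-adapted process $(E_n)_{n\in\mathbb N_0}$ is a $\mathsf P$-$e$-process if $\mathsf E_{\mathsf P}[E_\tau]\le1$ for every $(\mathcal F_n)_{n\in\mathbb N_0}$-stopping time $\tau$ (possibly taking the value $\infty$), with the convention $E_\infty=\limsup_nE_n$. *)

theory Defs
  imports "HOL-Probability.Probability" "HOL-Real_Asymp.Real_Asymp"
begin

text \<open>
  Sequences \<open>X\<^sub>1, X\<^sub>2, \<dots>\<close> are functions on \<^typ>\<open>nat\<close> whose value at \<open>0\<close> is never used.
\<close>

definition iid_seq :: "'a measure \<Rightarrow> (nat \<Rightarrow> 'a \<Rightarrow> real) \<Rightarrow> bool" where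
  "iid_seq M X \<longleftrightarrow>
     prob_space.indep_vars M (\<lambda>_. borel) X {1..} \<and>
     (\<forall>i\<ge>1. distr M borel (X i) = distr M borel (X 1))"

definition natural_filtration :: "'a measure \<Rightarrow> (nat \<Rightarrow> 'a \<Rightarrow> real) \<Rightarrow> nat \<Rightarrow> 'a measure" where
  "natural_filtration M X n =
     sigma (space M) {X i -` B \<inter> space M | i B. i \<in> {1..n} \<and> B \<in> sets borel}"

text \<open>
  The stopping times of the library take values in the index set of the filtration; here
  the value \<open>\<infinity>\<close> has to be allowed as well.
\<close>

definition ext_stopping_time :: "'a measure \<Rightarrow> (nat \<Rightarrow> 'a measure) \<Rightarrow> ('a \<Rightarrow> enat) \<Rightarrow> bool" where
  "ext_stopping_time M F \<tau> \<longleftrightarrow> (\<forall>n. {\<omega> \<in> space M. \<tau> \<omega> \<le> enat n} \<in> sets (F n))"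

definition stopped_value :: "(nat \<Rightarrow> 'a \<Rightarrow> ennreal) \<Rightarrow> ('a \<Rightarrow> enat) \<Rightarrow> 'a \<Rightarrow> ennreal" where
  "stopped_value E \<tau> \<omega> =
     (case \<tau> \<omega> of enat n \<Rightarrow> E n \<omega> | \<infinity> \<Rightarrow> limsup (\<lambda>n. E n \<omega>))"

text \<open>Nonnegativity is built into the type \<^typ>\<open>ennreal\<close>.\<close>

definition e_process :: "'a measure \<Rightarrow> (nat \<Rightarrow> 'a measure) \<Rightarrow> (nat \<Rightarrow> 'a \<Rightarrow> ennreal) \<Rightarrow> bool" where
  "e_process M F E \<longleftrightarrow>
     (\<forall>n. E n \<in> borel_measurable (F n)) \<and>
     (\<forall>\<tau>. ext_stopping_time M F \<tau> \<longrightarrow> (\<integral>\<^sup>+\<omega>. stopped_value E \<tau> \<omega> \<partial>M) \<le> 1)"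

definition partial_sum :: "(nat \<Rightarrow> 'a \<Rightarrow> real) \<Rightarrow> nat \<Rightarrow> 'a \<Rightarrow> real" where
  "partial_sum X n \<omega> = (\<Sum>i=1..n. X i \<omega>)"

definition tail_moment :: "'a measure \<Rightarrow> (nat \<Rightarrow> 'a \<Rightarrow> real) \<Rightarrow> real \<Rightarrow> real \<Rightarrow> real" where
  "tail_moment M X q x =
     (\<integral>\<omega>. \<bar>X 1 \<omega>\<bar> powr q * indicator {\<omega>. \<bar>X 1 \<omega>\<bar> powr q \<ge> x} \<omega> \<partial>M)"

definition threshold_cond ::
    "'a measure \<Rightarrow> (nat \<Rightarrow> 'a \<Rightarrow> real) \<Rightarrow> real \<Rightarrow> nat \<Rightarrow> nat \<Rightarrow> bool" where
  "threshold_cond M X q j m \<longleftrightarrow>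
     4 * exp (- (real m powr (1 / q - 1 / 2))) / (2 - q)
     + 451 * q * (real j)\<^sup>2 / (2 - q)
       * tail_moment M X q (real m powr (1 / 2 - q / 4) / (38 * real j powr q))
     \<le> 1 / 2 ^ j"

definition threshold :: "'a measure \<Rightarrow> (nat \<Rightarrow> 'a \<Rightarrow> real) \<Rightarrow> real \<Rightarrow> nat \<Rightarrow> nat" where
  "threshold M X q j = (LEAST m. m \<ge> 1 \<and> threshold_cond M X q j m)"

definition slln_e_process ::
    "'a measure \<Rightarrow> (nat \<Rightarrow> 'a \<Rightarrow> real) \<Rightarrow> real \<Rightarrow> nat \<Rightarrow> 'a \<Rightarrow> ennreal" where
  "slln_e_process M X q n \<omega> =
     (\<Sum>\<^sub>\<infinity>j\<in>{1..}.
        indicator {\<omega>. \<exists>k\<in>{threshold M X q j..n}.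
          \<bar>partial_sum X k \<omega>\<bar> / real k powr (1 / q) \<ge> 1 / real j} \<omega>)"

text \<open>
  The next lemmas show that the minimum in \<^const>\<open>threshold\<close> is attained, and that
  \<^const>\<open>slln_e_process\<close> takes only finite values.
\<close>

lemma tail_moment_tendsto_0:
  fixes X :: "nat \<Rightarrow> 'a \<Rightarrow> real"
  assumes [measurable]: "X 1 \<in> borel_measurable M"
    and int: "integrable M (\<lambda>\<omega>. \<bar>X 1 \<omega>\<bar> powr q)"
  shows "(tail_moment M X q \<longlongrightarrow> 0) at_top"
proof -
  have "((\<lambda>x. \<integral>\<omega>. \<bar>X 1 \<omega>\<bar> powr q * indicator {\<omega>. \<bar>X 1 \<omega>\<bar> powr q \<ge> x} \<omega> \<partial>M)
          \<longlongrightarrow> (\<integral>\<omega>. 0 \<partial>M)) at_top"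
  proof (rule integral_dominated_convergence_at_top[where w = "\<lambda>\<omega>. \<bar>X 1 \<omega>\<bar> powr q"])
    show "AE \<omega> in M. ((\<lambda>x. \<bar>X 1 \<omega>\<bar> powr q * indicator {\<omega>. \<bar>X 1 \<omega>\<bar> powr q \<ge> x} \<omega>)
            \<longlongrightarrow> 0) at_top"
    proof (rule AE_I2)
      fix \<omega>
      have "\<forall>\<^sub>F x in at_top. \<bar>X 1 \<omega>\<bar> powr q * indicator {\<omega>. \<bar>X 1 \<omega>\<bar> powr q \<ge> x} \<omega> = 0"
        using eventually_gt_at_top[of "\<bar>X 1 \<omega>\<bar> powr q"] by eventually_elim auto
      then show "((\<lambda>x. \<bar>X 1 \<omega>\<bar> powr q * indicator {\<omega>. \<bar>X 1 \<omega>\<bar> powr q \<ge> x} \<omega>)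
            \<longlongrightarrow> 0) at_top"
        by (rule tendsto_eventually)
    qed
  qed (use int in \<open>auto simp: indicator_def\<close>)
  then show ?thesis
    by (simp add: tail_moment_def[abs_def])
qed

lemma filterlim_powr_div:
  fixes a c :: real
  assumes "a > 0" "c > 0"
  shows "filterlim (\<lambda>m. real m powr a / c) at_top at_top"
  using assms by real_asymp

lemma threshold_exists:
  fixes X :: "nat \<Rightarrow> 'a \<Rightarrow> real"
  assumes X: "X 1 \<in> borel_measurable M"
    and int: "integrable M (\<lambda>\<omega>. \<bar>X 1 \<omega>\<bar> powr q)"
    and q: "1 \<le> q" "q < 2" and j: "j \<ge> 1"
  shows "\<exists>m\<ge>1. threshold_cond M X q j m"
proof -
  have q': "0 < 1 / q - 1 / 2" "0 < 1 / 2 - q / 4"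
    using q by (auto simp: field_simps)
  have e: "((\<lambda>m. exp (- (real m powr (1 / q - 1 / 2)))) \<longlongrightarrow> 0) at_top"
    using q'(1) by real_asymp
  have "38 * real j powr q > 0"
    using j by simp
  with q'(2) have "filterlim (\<lambda>m. real m powr (1 / 2 - q / 4) / (38 * real j powr q)) at_top at_top"
    by (rule filterlim_powr_div)
  from filterlim_compose[OF tail_moment_tendsto_0[where X = X, OF X int] this]
  have u: "((\<lambda>m. tail_moment M X q (real m powr (1 / 2 - q / 4) / (38 * real j powr q)))
             \<longlongrightarrow> 0) at_top" .
  have "((\<lambda>m. 4 * exp (- (real m powr (1 / q - 1 / 2))) / (2 - q)
     + 451 * q * (real j)\<^sup>2 / (2 - q)
       * tail_moment M X q (real m powr (1 / 2 - q / 4) / (38 * real j powr q)))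
     \<longlongrightarrow> 4 * 0 / (2 - q) + 451 * q * (real j)\<^sup>2 / (2 - q) * 0) at_top"
    using q by (intro tendsto_intros e u) auto
  then have "\<forall>\<^sub>F m in at_top. 4 * exp (- (real m powr (1 / q - 1 / 2))) / (2 - q)
     + 451 * q * (real j)\<^sup>2 / (2 - q)
       * tail_moment M X q (real m powr (1 / 2 - q / 4) / (38 * real j powr q)) < 1 / 2 ^ j"
    by (intro order_tendstoD(2)) auto
  then have "\<forall>\<^sub>F m in at_top. m \<ge> 1 \<and> threshold_cond M X q j m"
    using eventually_ge_at_top[of 1]
    by eventually_elim (auto simp: threshold_cond_def)
  then show ?thesis
    by (metis (no_types, lifting) eventually_at_top_linorder order_refl)
qed

lemma threshold:
  fixes X :: "nat \<Rightarrow> 'a \<Rightarrow> real"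
  assumes "X 1 \<in> borel_measurable M" "integrable M (\<lambda>\<omega>. \<bar>X 1 \<omega>\<bar> powr q)"
    and "1 \<le> q" "q < 2" "j \<ge> 1"
  shows "threshold M X q j \<ge> 1" "threshold_cond M X q j (threshold M X q j)"
  using LeastI_ex[of "\<lambda>m. m \<ge> 1 \<and> threshold_cond M X q j m"]
    threshold_exists[where X = X, OF assms] by (auto simp: threshold_def)

lemma finite_threshold_le:
  fixes X :: "nat \<Rightarrow> 'a \<Rightarrow> real"
  assumes X: "X 1 \<in> borel_measurable M" "integrable M (\<lambda>\<omega>. \<bar>X 1 \<omega>\<bar> powr q)"
    and q: "1 \<le> q" "q < 2"
  shows "finite {j \<in> {1..}. threshold M X q j \<le> n}"
proof -
  define c where "c = 4 * exp (- (real n powr (1 / q - 1 / 2))) / (2 - q)"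
  have c: "c > 0" using q by (simp add: c_def)
  have "((\<lambda>j. 1 / 2 ^ j :: real) \<longlongrightarrow> 0) at_top" by real_asymp
  from order_tendstoD(2)[OF this c] obtain N where N: "\<And>j. j \<ge> N \<Longrightarrow> 1 / 2 ^ j < c"
    by (auto simp: eventually_at_top_linorder)
  have "j < N" if j: "j \<ge> 1" "threshold M X q j \<le> n" for j
  proof (rule ccontr)
    assume "\<not> j < N"
    then have lt: "1 / 2 ^ j < c" using N by simp
    let ?m = "threshold M X q j"
    have "0 \<le> 451 * q * (real j)\<^sup>2 / (2 - q)
       * tail_moment M X q (real ?m powr (1 / 2 - q / 4) / (38 * real j powr q))"
      using q by (intro mult_nonneg_nonneg divide_nonneg_nonneg)
        (auto simp: tail_moment_def intro!: integral_nonneg_AE)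
    with threshold(2)[where X = X, OF X q j(1)]
    have "4 * exp (- (real ?m powr (1 / q - 1 / 2))) / (2 - q) \<le> 1 / 2 ^ j"
      by (simp add: threshold_cond_def)
    moreover have "real ?m powr (1 / q - 1 / 2) \<le> real n powr (1 / q - 1 / 2)"
      using j(2) q by (intro powr_mono2) (auto simp: field_simps)
    then have "c \<le> 4 * exp (- (real ?m powr (1 / q - 1 / 2))) / (2 - q)"
      unfolding c_def using q by (intro divide_right_mono mult_left_mono) auto
    ultimately show False using lt by simp
  qed
  then have "{j \<in> {1..}. threshold M X q j \<le> n} \<subseteq> {..<N}" by auto
  then show ?thesis by (rule finite_subset) simp
qed

lemma slln_e_process_finite:
  fixes X :: "nat \<Rightarrow> 'a \<Rightarrow> real"
  assumes X: "X 1 \<in> borel_measurable M" "integrable M (\<lambda>\<omega>. \<bar>X 1 \<omega>\<bar> powr q)"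
    and q: "1 \<le> q" "q < 2"
  shows "slln_e_process M X q n \<omega> < \<infinity>"
proof -
  let ?J = "{j \<in> {1..}. threshold M X q j \<le> n}"
  let ?f = "\<lambda>j. indicator {\<omega>. \<exists>k\<in>{threshold M X q j..n}.
          \<bar>partial_sum X k \<omega>\<bar> / real k powr (1 / q) \<ge> 1 / real j} \<omega> :: ennreal"
  have "slln_e_process M X q n \<omega> = infsum ?f ?J"
    unfolding slln_e_process_def
    by (rule infsum_cong_neutral) (auto simp: indicator_def)
  also have "\<dots> = sum ?f ?J"
    using finite_threshold_le[where X = X, OF X q] by (rule infsum_finite)
  also have "\<dots> < \<infinity>"
    using finite_threshold_le[where X = X, OF X q] by (simp add: indicator_def of_nat_less_top)
  finally show ?thesis .
qed

end

theory Submission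
  imports Defs
begin

text \<open>
  Write \<open>U\<close> for the tail moment and \<open>A\<^sub>j\<close> for the event that \<open>\<bar>S\<^sub>k\<bar> / k\<^bsup>1/q\<^esup> \<ge> 1/j\<close> for some
  \<open>k \<ge> m\<^sub>j\<close>. Every value of the process, and hence every stopped value, is at most
  \<open>\<Sum>\<^sub>j 1\<^bsub>A\<^sub>j\<^esub>\<close>. So the e-process property follows once \<open>P(A\<^sub>j) \<le> 2\<^bsup>-j\<^esup>\<close>, and by the
  choice of \<open>m\<^sub>j\<close> it remains to show that \<open>P(A\<^sub>j)\<close> is at most the left hand side of the
  threshold condition (lemma \<open>maximal_deviation\<close>). Divergence on the stated event is
  elementary: if the normalised sums reach some \<open>r > 0\<close> infinitely often, then every indicator with \<open>1/j < r\<close> is eventually one.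

  For the deviation bound let \<open>m = m\<^sub>j\<close>, \<open>\<epsilon> = 1/j\<close>, \<open>x = m\<^bsup>1/2-q/4\<^esup> / (38 j\<^sup>q)\<close>, and cut
  \<open>{m, m + 1, \<dots>}\<close> into blocks from \<open>n = 2\<^sup>i m\<close> to \<open>2n\<close>. Within one block (lemma
  \<open>block_bound\<close>) each summand is split according to the size of \<open>\<bar>X\<bar>\<^sup>q\<close>:

  \<^item> The part with \<open>\<bar>X\<bar>\<^sup>q < x\<close>, centered, is bounded, and Hoeffding's lemma makes it reach
    \<open>\<epsilon> n\<^bsup>1/q\<^esup> / 2\<close> with exponentially small probability. The level \<open>x\<close> does not depend on the
    block; the exponent is at least \<open>2 m\<^bsup>1/q-1/2\<^esup> 2\<^bsup>(2/q-1)i\<^esup>\<close>, so that the sum over the blocks is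
    at most \<open>4 exp(-m\<^bsup>1/q-1/2\<^esup>) / (2-q)\<close>.
  \<^item> The part with \<open>x \<le> \<bar>X\<bar>\<^sup>q < n\<close>, centered, reaches \<open>\<epsilon> n\<^bsup>1/q\<^esup> / 4\<close> with a probability that
    Kolmogorov's inequality bounds by its second moment.
  \<^item> The part with \<open>\<bar>X\<bar>\<^sup>q \<ge> n\<close> vanishes throughout the block, outside an event controlled by a
    union bound.
  \<^item> The centering terms of the first two parts add up to a drift of at most
    \<open>2 n\<^bsup>1/q\<^esup> U(n)\<close>, and the threshold condition itself forces \<open>U\<close> to be so small that this is
    at most \<open>\<epsilon> n\<^bsup>1/q\<^esup> / 4\<close>.

  For a fixed outcome, the second and third contributions are summed over all blocks before
  taking expectations. Both sums are geometric with their main term at the scale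
  \<open>n \<approx> \<bar>X\<bar>\<^sup>q\<close>, so each is a multiple of \<open>\<bar>X\<bar>\<^sup>q\<close> on \<open>{\<bar>X\<bar>\<^sup>q \<ge> x}\<close>, and the expectation is a multiple of
  \<open>U(x)\<close> (lemma \<open>sum_moment_blocks_le\<close>).

  Hoeffding's and Kolmogorov's bounds have to hold for the maximum of the partial sums in a block,
  not just for the last one. Both come from one submartingale argument,
  \<open>maximal_inequality\<close>.
\<close>

section \<open>A maximal inequality for bounded centered sequences\<close>

locale bounded_centered_sequence = prob_space +
  fixes V :: "nat \<Rightarrow> 'a \<Rightarrow> real" and B :: real
  assumes indep: "indep_vars (\<lambda>_. borel) V {1..}"
    and bounded: "\<And>i \<omega>. i \<ge> 1 \<Longrightarrow> \<omega> \<in> space M \<Longrightarrow> \<bar>V i \<omega>\<bar> \<le> B"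
    and centered: "\<And>i. i \<ge> 1 \<Longrightarrow> expectation (V i) = 0"
begin

lemma measurable_V: "i \<ge> 1 \<Longrightarrow> V i \<in> borel_measurable M"
  using indep by (auto simp: indep_vars_def)

lemma measurable_partial_sum [measurable]: "partial_sum V k \<in> borel_measurable M"
  unfolding partial_sum_def[abs_def] by (intro borel_measurable_sum measurable_V) auto

lemma partial_sum_bounded:
  assumes "\<omega> \<in> space M"
  shows "partial_sum V k \<omega> \<in> {- (real k * B)..real k * B}"
proof -
  have "\<bar>partial_sum V k \<omega>\<bar> \<le> (\<Sum>i=1..k. B)"
    unfolding partial_sum_def
    by (rule order_trans[OF sum_abs]) (intro sum_mono bounded, use assms in auto)
  then show ?thesis by (auto simp: abs_le_iff)
qed

lemma integrable_V: "i \<ge> 1 \<Longrightarrow> integrable M (V i)"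
  by (intro integrable_const_bound[where B = B]) (auto intro!: AE_I2 bounded measurable_V)

lemma integrable_continuous_of_sum:
  fixes f :: "real \<Rightarrow> real"
  assumes f: "continuous_on UNIV f" and A [measurable]: "A \<in> events"
  shows "integrable M (\<lambda>\<omega>. f (partial_sum V k \<omega>) * indicator A \<omega>)"
    and "integrable M (\<lambda>\<omega>. f (partial_sum V k \<omega>))"
proof -
  have [measurable]: "f \<in> borel_measurable borel"
    using f by (auto intro: borel_measurable_continuous_onI)
  have "compact (f ` {- (real k * B)..real k * B})"
    by (intro compact_continuous_image continuous_on_subset[OF f]) auto
  then obtain K where "\<forall>y\<in>f ` {- (real k * B)..real k * B}. norm y \<le> K"
    using compact_imp_bounded bounded_iff by metis
  with partial_sum_bounded have K: "\<bar>f (partial_sum V k \<omega>)\<bar> \<le> K" if "\<omega> \<in> space M" for \<omega>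
    using that by (auto simp del: atLeastAtMost_iff)
  then show int: "integrable M (\<lambda>\<omega>. f (partial_sum V k \<omega>))"
    by (intro integrable_const_bound[where B = K]) auto
  show "integrable M (\<lambda>\<omega>. f (partial_sum V k \<omega>) * indicator A \<omega>)"
    by (intro integrable_real_mult_indicator A int)
qed

text \<open>
  The past enters through the vector of the first \<open>k\<close> variables, because the maximal inequality needs
  functions of the whole path (has a level been reached by time \<open>k\<close>?), not only of the partial
  sum.
\<close>

lemma expectation_past_times_next:
  assumes G: "G \<in> borel_measurable (PiM {1..k} (\<lambda>_. borel))"
    and int: "integrable M (\<lambda>\<omega>. G (restrict (\<lambda>i. V i \<omega>) {1..k}))"
    and h [measurable]: "h \<in> borel_measurable borel"
    and inth: "integrable M (\<lambda>\<omega>. h (V (Suc k) \<omega>) :: real)"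
  shows "integrable M (\<lambda>\<omega>. G (restrict (\<lambda>i. V i \<omega>) {1..k}) * h (V (Suc k) \<omega>))"
    and "expectation (\<lambda>\<omega>. G (restrict (\<lambda>i. V i \<omega>) {1..k}) * h (V (Suc k) \<omega>))
         = expectation (\<lambda>\<omega>. G (restrict (\<lambda>i. V i \<omega>) {1..k})) * expectation (\<lambda>\<omega>. h (V (Suc k) \<omega>))"
proof -
  have "indep_var (PiM {1..k} (\<lambda>_. borel)) (\<lambda>\<omega>. restrict (\<lambda>i. V i \<omega>) {1..k})
          (PiM {Suc k} (\<lambda>_. borel)) (\<lambda>\<omega>. restrict (\<lambda>i. V i \<omega>) {Suc k})"
    by (rule indep_var_restrict[OF indep]) auto
  then have "indep_var borel (G \<circ> (\<lambda>\<omega>. restrict (\<lambda>i. V i \<omega>) {1..k}))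
          borel ((\<lambda>f. h (f (Suc k))) \<circ> (\<lambda>\<omega>. restrict (\<lambda>i. V i \<omega>) {Suc k}))"
    by (rule indep_var_compose) (use G in auto)
  then have *: "indep_var borel (\<lambda>\<omega>. G (restrict (\<lambda>i. V i \<omega>) {1..k}))
          borel (\<lambda>\<omega>. h (V (Suc k) \<omega>))"
    by (simp add: comp_def)
  show "integrable M (\<lambda>\<omega>. G (restrict (\<lambda>i. V i \<omega>) {1..k}) * h (V (Suc k) \<omega>))"
    by (rule indep_var_integrable[OF * int inth])
  show "expectation (\<lambda>\<omega>. G (restrict (\<lambda>i. V i \<omega>) {1..k}) * h (V (Suc k) \<omega>))
         = expectation (\<lambda>\<omega>. G (restrict (\<lambda>i. V i \<omega>) {1..k})) * expectation (\<lambda>\<omega>. h (V (Suc k) \<omega>))"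
    by (rule indep_var_lebesgue_integral[OF * int inth])
qed

lemma partial_sum_Suc: "partial_sum V (Suc k) \<omega> = partial_sum V k \<omega> + V (Suc k) \<omega>"
  by (simp add: partial_sum_def)

lemma partial_sum_restrict: "i \<le> k \<Longrightarrow> (\<Sum>l=1..i. restrict (\<lambda>i. V i \<omega>) {1..k} l) = partial_sum V i \<omega>"
  unfolding partial_sum_def by (intro sum.cong) auto

lemma measurable_sum_PiM:
  "i \<le> k \<Longrightarrow> (\<lambda>f. \<Sum>l=1..i::nat. f l) \<in> borel_measurable (PiM {1..k} (\<lambda>_. borel :: real measure))"
  by (intro borel_measurable_sum measurable_component_singleton) auto

text \<open>
  Doob's inequality for the submartingale \<open>\<phi>(S\<^sub>k)\<close>, with convexity of \<open>\<phi>\<close> given by a subgradient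
  \<open>\<phi>'\<close>. Let \<open>D k\<close> be the event that the level \<open>c\<close> has been reached by time \<open>k\<close>. By induction on \<open>k\<close>,
  \<open>c P(D k) \<le> E[\<phi>(S\<^sub>k); D k]\<close>: on \<open>D k\<close> the next increment raises \<open>\<phi>\<close> by at least
  \<open>\<phi>'(S\<^sub>k) V\<^bsub>k+1\<^esub>\<close>, which has mean zero on \<open>D k\<close> by independence, and on \<open>D (k+1) - D k\<close> the value
  of \<open>\<phi>\<close> at time \<open>k+1\<close> is at least \<open>c\<close>. Boundedness of the variables makes everything integrable.
\<close>

lemma maximal_inequality:
  fixes \<phi> \<phi>' :: "real \<Rightarrow> real"
  assumes cont: "continuous_on UNIV \<phi>" "continuous_on UNIV \<phi>'"
    and subgrad: "\<And>x r. \<phi> x + \<phi>' x * r \<le> \<phi> (x + r)"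
    and nonneg: "\<And>x. 0 \<le> \<phi> x" 
  shows "c * prob {\<omega>\<in>space M. \<exists>k\<in>{1..N}. c \<le> \<phi> (partial_sum V k \<omega>)}
         \<le> expectation (\<lambda>\<omega>. \<phi> (partial_sum V N \<omega>))"
proof -
  have [measurable]: "\<phi> \<in> borel_measurable borel" "\<phi>' \<in> borel_measurable borel"
    using cont by (auto intro: borel_measurable_continuous_onI)
  define D where "D k = {\<omega>\<in>space M. \<exists>i\<in>{1..k}. c \<le> \<phi> (partial_sum V i \<omega>)}" for k
  have D [measurable]: "D k \<in> events" for k
    unfolding D_def by measurable
  note int = integrable_continuous_of_sum
  have mart: "integrable M (\<lambda>\<omega>. \<phi>' (partial_sum V k \<omega>) * indicator (D k) \<omega> * V (Suc k) \<omega>) \<and>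
      expectation (\<lambda>\<omega>. \<phi>' (partial_sum V k \<omega>) * indicator (D k) \<omega> * V (Suc k) \<omega>) = 0" for k
  proof -
    \<comment> \<open>\<open>G\<close> expresses \<open>\<phi>'(S\<^sub>k)\<close> on \<open>D k\<close> as a function of the first \<open>k\<close> variables.\<close>
    define G where "G f = \<phi>' (\<Sum>l=1..k. f l) * (if \<exists>i\<in>{1..k}. c \<le> \<phi> (\<Sum>l=1..i. f l) then 1 else 0)"
      for f :: "nat \<Rightarrow> real"
    have sm [measurable]: "(\<lambda>f. \<Sum>l=1..i. f l) \<in> borel_measurable (PiM {1..k} (\<lambda>_. borel :: real measure))"
      if "i \<in> {1..k}" for i using that by (intro measurable_sum_PiM) auto
    have [measurable]: "(\<lambda>f. \<Sum>l=1..k. f l) \<in> borel_measurable (PiM {1..k} (\<lambda>_. borel :: real measure))"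
      by (intro measurable_sum_PiM) auto
    have Gm: "G \<in> borel_measurable (PiM {1..k} (\<lambda>_. borel))"
      unfolding G_def[abs_def] by measurable
    have eq: "G (restrict (\<lambda>i. V i \<omega>) {1..k}) = \<phi>' (partial_sum V k \<omega>) * indicator (D k) \<omega>"
      if "\<omega> \<in> space M" for \<omega>
    proof -
      have "(\<exists>i\<in>{1..k}. c \<le> \<phi> (\<Sum>l=1..i. restrict (\<lambda>i. V i \<omega>) {1..k} l)) \<longleftrightarrow> \<omega> \<in> D k"
        unfolding D_def using that
        by (simp add: partial_sum_restrict del: restrict_apply One_nat_def cong: bex_cong_simp)
      then show ?thesis
        unfolding G_def using partial_sum_restrict[of k k \<omega>] by (simp add: indicator_def del: restrict_apply)
    qed
    have intG: "integrable M (\<lambda>\<omega>. G (restrict (\<lambda>i. V i \<omega>) {1..k}))"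
      using int(1)[OF cont(2) D, of k k] by (rule back_subst[where P = "\<lambda>x. x"])
        (intro Bochner_Integration.integrable_cong refl eq[symmetric])
    have "integrable M (\<lambda>\<omega>. V (Suc k) \<omega>)" by (rule integrable_V) simp
    note next_step = expectation_past_times_next[OF Gm intG measurable_ident_sets[OF refl] this]
    have "expectation (\<lambda>\<omega>. V (Suc k) \<omega>) = 0" by (rule centered) simp
    with next_step(2) have 0: "expectation (\<lambda>\<omega>. G (restrict (\<lambda>i. V i \<omega>) {1..k}) * V (Suc k) \<omega>) = 0"
      by (simp only: mult_zero_right)
    have "integrable M (\<lambda>\<omega>. \<phi>' (partial_sum V k \<omega>) * indicator (D k) \<omega> * V (Suc k) \<omega>)"
      using next_step(1) by (rule back_subst[where P = "\<lambda>x. x"])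
        (intro Bochner_Integration.integrable_cong refl, simp only: eq)
    moreover have "expectation (\<lambda>\<omega>. \<phi>' (partial_sum V k \<omega>) * indicator (D k) \<omega> * V (Suc k) \<omega>) = 0"
      unfolding 0[symmetric] by (intro Bochner_Integration.integral_cong refl) (simp only: eq)
    ultimately show ?thesis ..
  qed
  have "c * prob (D k) \<le> expectation (\<lambda>\<omega>. \<phi> (partial_sum V k \<omega>) * indicator (D k) \<omega>)" for k
  proof (induction k)
    case 0
    show ?case by (simp add: D_def)
  next
    case (Suc k)
    define E where "E = D (Suc k) - D k"
    have E [measurable]: "E \<in> events" unfolding E_def by measurable
    have sub: "D k \<subseteq> D (Suc k)" unfolding D_def by fastforce
    then have meas: "prob (D (Suc k)) = prob (D k) + prob E"
      unfolding E_def by (subst finite_measure_Diff) auto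
    have onE: "c \<le> \<phi> (partial_sum V (Suc k) \<omega>)" if "\<omega> \<in> E" for \<omega>
      using that unfolding E_def D_def by (auto simp: le_Suc_eq)
    have "c * prob E = expectation (\<lambda>\<omega>. c * indicator E \<omega>)"
      by simp
    then have "c * prob (D (Suc k)) \<le>
        expectation (\<lambda>\<omega>. \<phi> (partial_sum V k \<omega>) * indicator (D k) \<omega>)
        + expectation (\<lambda>\<omega>. \<phi>' (partial_sum V k \<omega>) * indicator (D k) \<omega> * V (Suc k) \<omega>)
        + expectation (\<lambda>\<omega>. c * indicator E \<omega>)"
      using Suc mart[of k] by (simp add: meas distrib_left)
    also have "\<dots> = expectation (\<lambda>\<omega>. \<phi> (partial_sum V k \<omega>) * indicator (D k) \<omega>
        + \<phi>' (partial_sum V k \<omega>) * indicator (D k) \<omega> * V (Suc k) \<omega> + c * indicator E \<omega>)"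
    proof -
      have intE: "integrable M (\<lambda>\<omega>. c * indicator E \<omega>)"
        using E by (intro integrable_mult_right integrable_real_indicator) (auto simp: less_top[symmetric])
      note intD = int(1)[OF cont(1) D, of k k] mart[THEN conjunct1, of k]
      show ?thesis
        by (simp only: Bochner_Integration.integral_add[OF intD]
            Bochner_Integration.integral_add[OF Bochner_Integration.integrable_add[OF intD] intE])
    qed
    also have "\<dots> \<le> expectation (\<lambda>\<omega>. \<phi> (partial_sum V (Suc k) \<omega>) * indicator (D (Suc k)) \<omega>)"
    proof (rule integral_mono)
      show "integrable M (\<lambda>\<omega>. \<phi> (partial_sum V k \<omega>) * indicator (D k) \<omega>
        + \<phi>' (partial_sum V k \<omega>) * indicator (D k) \<omega> * V (Suc k) \<omega> + c * indicator E \<omega>)"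
        using mart[of k] int(1)[OF cont(1) D, of k k] E
        by (intro Bochner_Integration.integrable_add integrable_mult_right integrable_real_indicator)
          (auto simp: less_top[symmetric])
      fix \<omega> assume "\<omega> \<in> space M"
      show "\<phi> (partial_sum V k \<omega>) * indicator (D k) \<omega>
        + \<phi>' (partial_sum V k \<omega>) * indicator (D k) \<omega> * V (Suc k) \<omega> + c * indicator E \<omega>
        \<le> \<phi> (partial_sum V (Suc k) \<omega>) * indicator (D (Suc k)) \<omega>"
        using sub subgrad[of "partial_sum V k \<omega>" "V (Suc k) \<omega>"] onE[of \<omega>]
        by (cases "\<omega> \<in> D k"; cases "\<omega> \<in> D (Suc k)") (auto simp: E_def partial_sum_Suc)
    qed (rule int(1)[OF cont(1) D])
    finally show ?case .
  qed
  from this[of N] have "c * prob (D N) \<le> expectation (\<lambda>\<omega>. \<phi> (partial_sum V N \<omega>) * indicator (D N) \<omega>)" .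
  also have "\<dots> \<le> expectation (\<lambda>\<omega>. \<phi> (partial_sum V N \<omega>))"
    using int(2)[OF cont(1) sets.top, of N] int(1)[OF cont(1) D, of N N] nonneg
    by (intro integral_mono) (auto simp: indicator_def cong: Bochner_Integration.integrable_cong)
  finally show ?thesis unfolding D_def .
qed

lemma expectation_square_partial_sum:
  assumes "\<And>i. i \<ge> 1 \<Longrightarrow> expectation (\<lambda>\<omega>. (V i \<omega>)\<^sup>2) \<le> v"
  shows "expectation (\<lambda>\<omega>. (partial_sum V N \<omega>)\<^sup>2) \<le> real N * v"
proof (induction N)
  case 0
  then show ?case by (simp add: partial_sum_def)
next
  case (Suc k)
  have intS: "integrable M (partial_sum V k)"
    using integrable_continuous_of_sum(2)[of "\<lambda>x. x" "{}" k] by (simp add: continuous_on_id)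
  have intS2: "integrable M (\<lambda>\<omega>. (partial_sum V k \<omega>)\<^sup>2)"
    by (intro integrable_continuous_of_sum(2)[of "\<lambda>x. x\<^sup>2" "{}"] continuous_intros) auto
  have intV2: "integrable M (\<lambda>\<omega>. (V (Suc k) \<omega>)\<^sup>2)"
  proof (rule integrable_const_bound[where B = "B\<^sup>2"])
    show "AE \<omega> in M. norm ((V (Suc k) \<omega>)\<^sup>2) \<le> B\<^sup>2"
    proof (rule AE_I2)
      fix \<omega> assume "\<omega> \<in> space M"
      then have "\<bar>V (Suc k) \<omega>\<bar>\<^sup>2 \<le> B\<^sup>2"
        by (intro power_mono bounded) auto
      then show "norm ((V (Suc k) \<omega>)\<^sup>2) \<le> B\<^sup>2" by simp
    qed
  qed (use measurable_V[of "Suc k"] in measurable)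
  have Gm: "(\<lambda>f. \<Sum>l=1..k. f l) \<in> borel_measurable (PiM {1..k} (\<lambda>_. borel :: real measure))"
    by (rule measurable_sum_PiM) simp
  have cross: "integrable M (\<lambda>\<omega>. partial_sum V k \<omega> * V (Suc k) \<omega>)"
      "expectation (\<lambda>\<omega>. partial_sum V k \<omega> * V (Suc k) \<omega>) = 0"
    using expectation_past_times_next[OF Gm, of "\<lambda>x. x"] intS integrable_V[of "Suc k"] centered[of "Suc k"]
    unfolding partial_sum_restrict[OF order_refl] by auto
  have "expectation (\<lambda>\<omega>. (partial_sum V (Suc k) \<omega>)\<^sup>2) =
      expectation (\<lambda>\<omega>. (partial_sum V k \<omega>)\<^sup>2 + 2 * (partial_sum V k \<omega> * V (Suc k) \<omega>) + (V (Suc k) \<omega>)\<^sup>2)"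
    by (simp add: partial_sum_Suc power2_sum algebra_simps)
  also have "\<dots> = expectation (\<lambda>\<omega>. (partial_sum V k \<omega>)\<^sup>2) + expectation (\<lambda>\<omega>. (V (Suc k) \<omega>)\<^sup>2)"
    using intS2 intV2 cross by simp
  also have "\<dots> \<le> real (Suc k) * v"
    using Suc assms[of "Suc k"] by (simp add: algebra_simps)
  finally show ?case .
qed

text \<open>
  Case \<open>\<phi>(y) = y\<^sup>2\<close> of the maximal inequality.
\<close>

lemma kolmogorov_maximal:
  assumes v: "\<And>i. i \<ge> 1 \<Longrightarrow> expectation (\<lambda>\<omega>. (V i \<omega>)\<^sup>2) \<le> v" and t: "t > 0"
  shows "prob {\<omega>\<in>space M. \<exists>k\<in>{1..N}. t \<le> \<bar>partial_sum V k \<omega>\<bar>} \<le> real N * v / t\<^sup>2"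
proof -
  have "t\<^sup>2 * prob {\<omega>\<in>space M. \<exists>k\<in>{1..N}. t\<^sup>2 \<le> (partial_sum V k \<omega>)\<^sup>2}
      \<le> expectation (\<lambda>\<omega>. (partial_sum V N \<omega>)\<^sup>2)"
  proof (rule maximal_inequality[where \<phi>' = "\<lambda>x. 2 * x"])
    show "x\<^sup>2 + 2 * x * r \<le> (x + r)\<^sup>2" for x r :: real
      by (simp add: power2_sum)
  qed (auto intro!: continuous_intros)
  also have "\<dots> \<le> real N * v"
    by (rule expectation_square_partial_sum[OF v])
  also have "{\<omega>\<in>space M. \<exists>k\<in>{1..N}. t\<^sup>2 \<le> (partial_sum V k \<omega>)\<^sup>2} =
      {\<omega>\<in>space M. \<exists>k\<in>{1..N}. t \<le> \<bar>partial_sum V k \<omega>\<bar>}"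
    using t by (simp add: abs_le_square_iff[symmetric])
  finally show ?thesis
    using t by (simp add: field_simps)
qed

lemma expectation_exp_partial_sum:
  assumes e: "\<And>i. i \<ge> 1 \<Longrightarrow> expectation (\<lambda>\<omega>. exp (s * V i \<omega>)) \<le> exp v"
  shows "expectation (\<lambda>\<omega>. exp (s * partial_sum V N \<omega>)) \<le> exp (real N * v)"
proof (induction N)
  case 0
  then show ?case by (simp add: partial_sum_def prob_space)
next
  case (Suc k)
  have intS: "integrable M (\<lambda>\<omega>. exp (s * partial_sum V k \<omega>))"
    by (intro integrable_continuous_of_sum(2)[of "\<lambda>x. exp (s * x)" "{}"] continuous_intros) auto
  have intV: "integrable M (\<lambda>\<omega>. exp (s * V (Suc k) \<omega>))"
  proof (rule integrable_const_bound[where B = "exp (\<bar>s\<bar> * B)"])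
    show "AE \<omega> in M. norm (exp (s * V (Suc k) \<omega>)) \<le> exp (\<bar>s\<bar> * B)"
    proof (rule AE_I2)
      fix \<omega> assume "\<omega> \<in> space M"
      have "s * V (Suc k) \<omega> \<le> \<bar>s\<bar> * \<bar>V (Suc k) \<omega>\<bar>"
        by (metis abs_ge_self abs_mult)
      also have "\<dots> \<le> \<bar>s\<bar> * B"
        using bounded[of "Suc k"] \<open>\<omega> \<in> space M\<close> by (intro mult_left_mono) auto
      finally show "norm (exp (s * V (Suc k) \<omega>)) \<le> exp (\<bar>s\<bar> * B)" by simp
    qed
  qed (use measurable_V[of "Suc k"] in measurable)
  have Gm: "(\<lambda>f. exp (s * (\<Sum>l=1..k. f l))) \<in> borel_measurable (PiM {1..k} (\<lambda>_. borel :: real measure))"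
    using measurable_sum_PiM[of k k] by measurable
  have "expectation (\<lambda>\<omega>. exp (s * partial_sum V (Suc k) \<omega>)) =
      expectation (\<lambda>\<omega>. exp (s * partial_sum V k \<omega>)) * expectation (\<lambda>\<omega>. exp (s * V (Suc k) \<omega>))"
    using expectation_past_times_next(2)[OF Gm, of "\<lambda>x. exp (s * x)"] intS intV
    unfolding partial_sum_restrict[OF order_refl] by (simp add: partial_sum_Suc distrib_left exp_add)
  also have "\<dots> \<le> exp (real k * v) * exp v"
    using Suc e[of "Suc k"] by (intro mult_mono) auto
  finally show ?case by (simp add: exp_add[symmetric] algebra_simps)
qed

text \<open>
  Here \<open>\<phi>(y) = exp(sy) + exp(-sy)\<close>, which handles both signs of the sum at once: it is at least
  \<open>exp(st)\<close> as soon as \<open>\<bar>y\<bar> \<ge> t\<close>. The interval containing \<open>V i\<close> has length \<open>2b\<close> wherever it lies, so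
  Hoeffding's lemma gives \<open>E exp(\<plusminus>s V i) \<le> exp(s\<^sup>2 b\<^sup>2 / 2)\<close>.
\<close>

lemma hoeffding_maximal:
  assumes b: "b > 0"
    and range: "\<And>i \<omega>. i \<ge> 1 \<Longrightarrow> \<omega> \<in> space M \<Longrightarrow> V i \<omega> \<in> {a i - b..a i + b}"
    and t: "t > 0" and N: "N \<ge> 1"
  shows "prob {\<omega>\<in>space M. \<exists>k\<in>{1..N}. t \<le> \<bar>partial_sum V k \<omega>\<bar>}
         \<le> 2 * exp (- t\<^sup>2 / (2 * real N * b\<^sup>2))"
proof -
  \<comment> \<open>This choice minimises \<open>N s\<^sup>2 b\<^sup>2 / 2 - s t\<close>.\<close>
  define s where "s = t / (real N * b\<^sup>2)"
  have s: "s > 0" using b t N by (simp add: s_def)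
  have mgf_nn: "nn_integral M (\<lambda>\<omega>. exp (s * W \<omega>)) \<le> ennreal (exp (s\<^sup>2 * b\<^sup>2 / 2))"
    if W: "W \<in> borel_measurable M" "expectation W = 0" "\<And>\<omega>. \<omega> \<in> space M \<Longrightarrow> W \<omega> \<in> {a' - b..a' + b}" for W a'
  proof -
    interpret W: interval_bounded_random_variable M W "a' - b" "a' + b"
      using W by unfold_locales auto
    have "s\<^sup>2 * (a' + b - (a' - b))\<^sup>2 / 8 = s\<^sup>2 * b\<^sup>2 / 2"
      by (simp add: power2_eq_square)
    then show ?thesis using W.Hoeffdings_lemma_nn_integral_0[OF s W(2)] by (simp only:)
  qed
  have mgf: "expectation (\<lambda>\<omega>. exp (s * W \<omega>)) \<le> exp (s\<^sup>2 * b\<^sup>2 / 2)"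
    if "W \<in> borel_measurable M" "expectation W = 0" "\<And>\<omega>. \<omega> \<in> space M \<Longrightarrow> W \<omega> \<in> {a' - b..a' + b}" for W a'
    using mgf_nn[OF that] that(1)
    by (subst integral_eq_nn_integral) (auto simp: enn2real_leI)
  have up: "expectation (\<lambda>\<omega>. exp (s * partial_sum V N \<omega>)) \<le> exp (real N * (s\<^sup>2 * b\<^sup>2 / 2))"
    using range by (intro expectation_exp_partial_sum mgf measurable_V centered) auto
  have down: "expectation (\<lambda>\<omega>. exp (- s * partial_sum V N \<omega>)) \<le> exp (real N * (s\<^sup>2 * b\<^sup>2 / 2))"
  proof (rule expectation_exp_partial_sum)
    fix i :: nat assume i: "i \<ge> 1"
    have "V i \<omega> \<le> a i + b \<and> a i - b \<le> V i \<omega>" if "\<omega> \<in> space M" for \<omega>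
      using range[OF i that] by auto
    then have "expectation (\<lambda>\<omega>. exp (s * (- V i \<omega>))) \<le> exp (s\<^sup>2 * b\<^sup>2 / 2)"
      using i by (intro mgf[of _ "- a i"]) (auto simp: measurable_V centered algebra_simps)
    then show "expectation (\<lambda>\<omega>. exp (- s * V i \<omega>)) \<le> exp (s\<^sup>2 * b\<^sup>2 / 2)" by simp
  qed
  let ?\<phi> = "\<lambda>x. exp (s * x) + exp (- s * x)"
  have int: "integrable M (\<lambda>\<omega>. exp (r * partial_sum V N \<omega>))" for r
    by (intro integrable_continuous_of_sum(2)[of "\<lambda>x. exp (r * x)" "{}"] continuous_intros) auto
  have "exp (s * t) * prob {\<omega>\<in>space M. \<exists>k\<in>{1..N}. exp (s * t) \<le> ?\<phi> (partial_sum V k \<omega>)}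
      \<le> expectation (\<lambda>\<omega>. ?\<phi> (partial_sum V N \<omega>))"
  proof (rule maximal_inequality[where \<phi>' = "\<lambda>x. s * exp (s * x) - s * exp (- s * x)"])
    fix x r :: real
    have "exp (s * x) * (1 + s * r) + exp (- s * x) * (1 + (- s * r))
        \<le> exp (s * x) * exp (s * r) + exp (- s * x) * exp (- s * r)"
      by (intro add_mono mult_left_mono exp_ge_add_one_self) auto
    then show "?\<phi> x + (s * exp (s * x) - s * exp (- s * x)) * r \<le> ?\<phi> (x + r)"
      by (simp add: exp_add[symmetric] algebra_simps)
  qed (auto intro!: continuous_intros)
  also have "\<dots> \<le> 2 * exp (real N * (s\<^sup>2 * b\<^sup>2 / 2))"
    using up down int[of s] int[of "- s"] by simp
  finally have "exp (s * t) * prob {\<omega>\<in>space M. \<exists>k\<in>{1..N}. exp (s * t) \<le> ?\<phi> (partial_sum V k \<omega>)}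
      \<le> 2 * exp (real N * (s\<^sup>2 * b\<^sup>2 / 2))" .
  moreover have "prob {\<omega>\<in>space M. \<exists>k\<in>{1..N}. t \<le> \<bar>partial_sum V k \<omega>\<bar>}
      \<le> prob {\<omega>\<in>space M. \<exists>k\<in>{1..N}. exp (s * t) \<le> ?\<phi> (partial_sum V k \<omega>)}"
  proof (rule finite_measure_mono)
    have "exp (s * t) \<le> ?\<phi> x" if "t \<le> \<bar>x\<bar>" for x
    proof (cases "x \<ge> 0")
      case True
      then have "exp (s * t) \<le> exp (s * x)" using s that by simp
      then show ?thesis by (simp add: add_increasing2)
    next
      case False
      then have "s * t \<le> s * (- x)" using s that by (intro mult_left_mono) auto
      then have "exp (s * t) \<le> exp (- s * x)" by simp
      then show ?thesis by (simp add: add_increasing)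
    qed
    then show "{\<omega>\<in>space M. \<exists>k\<in>{1..N}. t \<le> \<bar>partial_sum V k \<omega>\<bar>}
      \<subseteq> {\<omega>\<in>space M. \<exists>k\<in>{1..N}. exp (s * t) \<le> ?\<phi> (partial_sum V k \<omega>)}"
      by blast
  qed measurable
  ultimately have "exp (s * t) * prob {\<omega>\<in>space M. \<exists>k\<in>{1..N}. t \<le> \<bar>partial_sum V k \<omega>\<bar>}
      \<le> 2 * exp (real N * (s\<^sup>2 * b\<^sup>2 / 2))"
    by (meson exp_ge_zero mult_left_mono order_trans)
  then have "prob {\<omega>\<in>space M. \<exists>k\<in>{1..N}. t \<le> \<bar>partial_sum V k \<omega>\<bar>}
      \<le> 2 * exp (real N * (s\<^sup>2 * b\<^sup>2 / 2)) / exp (s * t)"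
    by (simp add: field_simps)
  also have "\<dots> = 2 * exp (real N * (s\<^sup>2 * b\<^sup>2 / 2) - s * t)"
    by (simp add: exp_diff)
  also have "real N * (s\<^sup>2 * b\<^sup>2 / 2) - s * t = - t\<^sup>2 / (2 * real N * b\<^sup>2)"
    using b N unfolding s_def by (simp add: field_simps power2_eq_square)
  finally show ?thesis .
qed

end

section \<open>Sums along dyadic scales\<close>

text \<open>
  A linear minorant, valid because \<open>ln 2 \<ge> 1/2\<close>.
\<close>

lemma two_powr_ge:
  fixes y :: real
  assumes "0 \<le> y"
  shows "1 + y / 2 \<le> 2 powr y"
proof -
  have "1 / 2 \<le> ln (2 :: real)" using ln2_ge_two_thirds by simp
  then have "1 + y / 2 \<le> 1 + y * ln 2" using assms mult_left_mono[of "1/2" "ln 2" y] by simp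
  also have "\<dots> \<le> exp (y * ln 2)" by (rule exp_ge_add_one_self)
  finally show ?thesis by (simp add: powr_def)
qed

text \<open>
  The sum is geometric, so it is at most twice its last nonzero term, which is at most \<open>w\<close>.
\<close>

lemma sum_dyadic_le:
  fixes m w :: real
  assumes "0 \<le> m" "0 \<le> w"
  shows "(\<Sum>i<I. if m * 2 ^ i \<le> w then m * 2 ^ i else 0) \<le> 2 * w"
proof (induction I)
  case (Suc I)
  show ?case
  proof (cases "m * 2 ^ I \<le> w")
    case True
    have "(\<Sum>i<Suc I. if m * 2 ^ i \<le> w then m * 2 ^ i else 0) \<le> (\<Sum>i<Suc I. m * 2 ^ i)"
      using assms by (intro sum_mono) auto
    also have "\<dots> = m * (2 ^ Suc I - 1)"
      by (simp add: sum_distrib_left[symmetric] geometric_sum del: sum.lessThan_Suc)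
    also have "\<dots> \<le> 2 * w" using True assms by (simp add: algebra_simps)
    finally show ?thesis .
  qed (use Suc in simp)
qed (use assms in simp)

text \<open>
  The terms vanish until \<open>m 2\<^sup>i\<close> exceeds \<open>w\<close>. From there on they are dominated by a geometric series
  with first term \<open>w\<^bsup>-y\<^esup>\<close>. The induction peels off the first term, replacing \<open>m\<close> by \<open>2m\<close>.
\<close>

lemma sum_dyadic_powr_le:
  fixes m w y :: real
  assumes "0 < m" "0 < w" "0 < y"
  shows "(\<Sum>i<I. if w < m * 2 ^ i then (m * 2 ^ i) powr (- y) else 0) \<le> w powr (- y) / (1 - 2 powr (- y))"
  using assms(1)
proof (induction I arbitrary: m)
  case 0
  have "2 powr (- y) \<le> 1" using assms by (simp add: powr_minus ge_one_powr_ge_zero inverse_le_1_iff)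
  then show ?case by simp
next
  case (Suc I)
  let ?r = "2 powr (- y)"
  have r: "0 < ?r" "?r < 1" using assms(3) by (auto simp: powr_minus inverse_less_1_iff)
  show ?case
  proof (cases "w < m")
    case True
    have "(\<Sum>i<Suc I. if w < m * 2 ^ i then (m * 2 ^ i) powr (- y) else 0)
        \<le> (\<Sum>i<Suc I. w powr (- y) * ?r ^ i)"
    proof (rule sum_mono)
      fix i
      have "(m * 2 ^ i) powr (- y) = m powr (- y) * ?r ^ i"
        using Suc.prems by (simp add: powr_mult powr_realpow[symmetric] powr_powr powr_power mult.commute)
      also have "\<dots> \<le> w powr (- y) * ?r ^ i"
        using True assms by (intro mult_right_mono powr_mono2') auto
      finally show "(if w < m * 2 ^ i then (m * 2 ^ i) powr (- y) else 0) \<le> w powr (- y) * ?r ^ i"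
        by simp
    qed
    also have "\<dots> = w powr (- y) * ((1 - ?r ^ Suc I) / (1 - ?r))"
      using r assms(3) by (simp add: sum_distrib_left[symmetric] sum_gp_strict del: sum.lessThan_Suc)
    also have "\<dots> \<le> w powr (- y) * (1 / (1 - ?r))"
      using r by (intro mult_left_mono divide_right_mono) auto
    finally show ?thesis by simp
  next
    case False
    have "(\<Sum>i<Suc I. if w < m * 2 ^ i then (m * 2 ^ i) powr (- y) else 0)
        = (\<Sum>i<I. if w < (m * 2) * 2 ^ i then ((m * 2) * 2 ^ i) powr (- y) else 0)"
      using False by (simp add: sum.lessThan_Suc_shift mult.assoc cong: if_cong del: sum.lessThan_Suc)
    also have "\<dots> \<le> w powr (- y) / (1 - ?r)"
      by (rule Suc.IH) (use Suc.prems in simp)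
    finally show ?thesis .
  qed
qed

lemma inverse_one_minus_two_powr_le:
  fixes q :: real
  assumes "1 \<le> q" "q < 2"
  shows "1 / (1 - 2 powr (- (2 / q - 1))) \<le> 3 * q / (2 - q)"
proof -
  define y where "y = 2 / q - 1"
  have y: "y > 0" using assms by (simp add: y_def field_simps)
  have g: "1 + y / 2 \<le> 2 powr y" by (rule two_powr_ge) (use y in simp)
  have "1 / (1 - inverse p) = 1 + 1 / (p - 1)" if "p > 1" for p :: real
    using that by (simp add: field_simps)
  moreover have "2 powr y > 1" by (rule less_le_trans[OF _ g]) (use y in simp)
  ultimately have "1 / (1 - 2 powr (- y)) = 1 + 1 / (2 powr y - 1)"
    unfolding powr_minus[of 2 y] by blast
  also have "\<dots> \<le> 1 + 1 / (y / 2)"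
    using g y by (intro add_left_mono divide_left_mono mult_pos_pos) auto
  also have "\<dots> = (2 + q) / (2 - q)"
    using assms unfolding y_def by (simp add: field_simps)
  also have "\<dots> \<le> 3 * q / (2 - q)"
    using assms by (intro divide_right_mono) auto
  finally show ?thesis by (simp only: y_def)
qed

text \<open>
  Replacing the growing factor \<open>2 powr \<dots>\<close> by its linear minorant leaves a geometric series. The
  factor \<open>2\<close> in the exponent makes up for the slope \<open>1/2\<close> of the minorant, so the ratio is at most
  \<open>exp(-(2/q-1))\<close>, and \<open>1 + 1 / (2/q-1) = 2 / (2-q)\<close>.
\<close>

lemma sum_exp_dyadic_le:
  fixes q \<mu> :: real
  assumes q: "1 \<le> q" "q < 2" and \<mu>: "1 \<le> \<mu>"
  shows "(\<Sum>i<I. 2 * exp (- 2 * \<mu> * 2 powr ((2 / q - 1) * real i))) \<le> 4 * exp (- \<mu>) / (2 - q)"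
proof -
  let ?y = "2 / q - 1"
  have y: "?y > 0" using assms by (simp add: field_simps)
  have "(\<Sum>i<I. 2 * exp (- 2 * \<mu> * 2 powr (?y * real i))) \<le> (\<Sum>i<I. 2 * exp (- \<mu>) * exp (- ?y) ^ i)"
  proof (rule sum_mono)
    fix i
    have "\<mu> + ?y * real i \<le> 2 * \<mu> * (1 + ?y * real i / 2)"
    proof -
      have "\<mu> + z \<le> 2 * \<mu> * (1 + z / 2)" if "0 \<le> z" for z
        using \<mu> that mult_right_mono[of 1 \<mu> z] by (simp add: distrib_left)
      from this[of "?y * real i"] show ?thesis using y by simp
    qed
    also have "\<dots> \<le> 2 * \<mu> * 2 powr (?y * real i)"
      using \<mu> y by (intro mult_left_mono two_powr_ge) auto
    finally have "- 2 * \<mu> * 2 powr (?y * real i) \<le> - \<mu> + real i * (- ?y)"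
      by (simp add: algebra_simps)
    then show "2 * exp (- 2 * \<mu> * 2 powr (?y * real i)) \<le> 2 * exp (- \<mu>) * exp (- ?y) ^ i"
      by (simp only: exp_of_nat_mult[symmetric] mult.assoc exp_add[symmetric] mult_le_cancel_left_pos
          zero_less_numeral exp_le_cancel_iff)
  qed
  also have "\<dots> = 2 * exp (- \<mu>) * ((1 - exp (- ?y) ^ I) / (1 - exp (- ?y)))"
    using y q by (simp add: sum_distrib_left[symmetric] sum_gp_strict)
  also have "\<dots> \<le> 2 * exp (- \<mu>) * (1 / (1 - exp (- ?y)))"
    using y by (intro mult_left_mono divide_right_mono) auto
  also have "1 / (1 - exp (- ?y)) = 1 + 1 / (exp ?y - 1)"
    using y unfolding exp_minus[of ?y] by (simp add: divide_simps)
  also have "2 * exp (- \<mu>) * (1 + 1 / (exp ?y - 1)) \<le> 2 * exp (- \<mu>) * (1 + 1 / ?y)"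
    using y exp_ge_add_one_self[of ?y]
    by (intro mult_left_mono add_left_mono divide_left_mono mult_pos_pos) auto
  also have "1 + 1 / ?y = 2 / (2 - q)"
    using q by (simp add: field_simps)
  finally show ?thesis by (simp add: mult.assoc)
qed

section \<open>Deviations within one dyadic block\<close>

lemma (in prob_space) bounded_centered_sequence_truncation:
  fixes X :: "nat \<Rightarrow> 'a \<Rightarrow> real" and f :: "real \<Rightarrow> real"
  assumes iid: "iid_seq M X" and f [measurable]: "f \<in> borel_measurable borel"
    and K: "\<And>r. \<bar>f r\<bar> \<le> K"
  shows "bounded_centered_sequence M (\<lambda>i \<omega>. f (X i \<omega>) - expectation (\<lambda>\<omega>. f (X 1 \<omega>))) (2 * K)"
    and "\<And>i. i \<ge> 1 \<Longrightarrow> expectation (\<lambda>\<omega>. (f (X i \<omega>) - expectation (\<lambda>\<omega>. f (X 1 \<omega>)))\<^sup>2)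
           \<le> expectation (\<lambda>\<omega>. (f (X 1 \<omega>))\<^sup>2)"
proof -
  have X [measurable]: "X i \<in> borel_measurable M" if "i \<ge> 1" for i
    using iid that by (auto simp: iid_seq_def indep_vars_def)
  have transfer: "expectation (\<lambda>\<omega>. g (X i \<omega>)) = expectation (\<lambda>\<omega>. g (X 1 \<omega>))"
    if i: "i \<ge> 1" and g [measurable]: "g \<in> borel_measurable borel" for g :: "real \<Rightarrow> real" and i
  proof -
    have "expectation (\<lambda>\<omega>. g (X i \<omega>)) = integral\<^sup>L (distr M borel (X i)) g"
      by (intro integral_distr[symmetric] X i g)
    also have "distr M borel (X i) = distr M borel (X 1)"
      using iid i unfolding iid_seq_def by blast
    also have "integral\<^sup>L (distr M borel (X 1)) g = expectation (\<lambda>\<omega>. g (X 1 \<omega>))"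
      by (intro integral_distr X order_refl g)
    finally show ?thesis .
  qed
  let ?a = "expectation (\<lambda>\<omega>. f (X 1 \<omega>))"
  have int: "integrable M (\<lambda>\<omega>. f (X i \<omega>))" if "i \<ge> 1" for i
    using X[OF that] K by (intro integrable_const_bound[where B = K]) auto
  have a: "\<bar>?a\<bar> \<le> K"
  proof -
    have "\<bar>?a\<bar> \<le> expectation (\<lambda>\<omega>. \<bar>f (X 1 \<omega>)\<bar>)" by (rule integral_abs_bound)
    also have "\<dots> \<le> expectation (\<lambda>\<omega>. K)"
      using int[of 1] K by (intro integral_mono) auto
    finally show ?thesis by (simp add: prob_space)
  qed
  show "bounded_centered_sequence M (\<lambda>i \<omega>. f (X i \<omega>) - ?a) (2 * K)"
  proof
    show "indep_vars (\<lambda>_. borel) (\<lambda>i \<omega>. f (X i \<omega>) - ?a) {1..}"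
      using iid by (intro indep_vars_compose2[where Y = "\<lambda>_ r. f r - ?a" and M' = "\<lambda>_. borel"])
        (auto simp: iid_seq_def)
    show "\<bar>f (X i \<omega>) - ?a\<bar> \<le> 2 * K" for i \<omega>
      using K[of "X i \<omega>"] a by linarith
    show "expectation (\<lambda>\<omega>. f (X i \<omega>) - ?a) = 0" if "i \<ge> 1" for i
      using int[OF that] transfer[OF that f] by (simp add: prob_space)
  qed
  show "expectation (\<lambda>\<omega>. (f (X i \<omega>) - ?a)\<^sup>2) \<le> expectation (\<lambda>\<omega>. (f (X 1 \<omega>))\<^sup>2)" if i: "i \<ge> 1" for i
  proof -
    have sq: "(f r)\<^sup>2 \<le> K\<^sup>2" for r
      using power_mono[OF K[of r], of 2] by simp
    have "integrable M (\<lambda>\<omega>. (f (X i \<omega>))\<^sup>2)"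
      using X[OF i] sq by (intro integrable_const_bound[where B = "K\<^sup>2"]) auto
    then have "expectation (\<lambda>\<omega>. (f (X i \<omega>) - ?a)\<^sup>2) = expectation (\<lambda>\<omega>. (f (X i \<omega>))\<^sup>2) - ?a\<^sup>2"
      using variance_eq[OF int[OF i]] transfer[OF i f] by simp
    also have "\<dots> \<le> expectation (\<lambda>\<omega>. (f (X 1 \<omega>))\<^sup>2)"
      using transfer[OF i, of "\<lambda>r. (f r)\<^sup>2"] by simp
    finally show ?thesis .
  qed
qed

locale centered_iid_sequence = prob_space +
  fixes X :: "nat \<Rightarrow> 'a \<Rightarrow> real" and q :: real
  assumes iid: "iid_seq M X" and q: "1 \<le> q" "q < 2"
    and moment: "integrable M (\<lambda>\<omega>. \<bar>X 1 \<omega>\<bar> powr q)"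
    and centered: "expectation (X 1) = 0"
begin

lemma measurable_X: "i \<ge> 1 \<Longrightarrow> X i \<in> borel_measurable M"
  using iid by (auto simp: iid_seq_def indep_vars_def)

lemma measurable_X1 [measurable]: "X (Suc 0) \<in> borel_measurable M"
  by (rule measurable_X) simp

lemma measurable_partial_sum [measurable]: "partial_sum X k \<in> borel_measurable M"
  unfolding partial_sum_def[abs_def] by (intro borel_measurable_sum measurable_X) auto

lemma integrable_tail: "integrable M (\<lambda>\<omega>. \<bar>X 1 \<omega>\<bar> powr q * indicator {\<omega>. x \<le> \<bar>X 1 \<omega>\<bar> powr q} \<omega>)"
  using moment by (rule Bochner_Integration.integrable_bound) (auto simp: indicator_def)

lemma tail_moment_antimono: "x \<le> y \<Longrightarrow> tail_moment M X q y \<le> tail_moment M X q x"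
  unfolding tail_moment_def by (intro integral_mono integrable_tail) (auto simp: indicator_def)

lemma tail_moment_nonneg: "0 \<le> tail_moment M X q x"
  unfolding tail_moment_def by (intro integral_nonneg_AE) auto

lemma integrable_X1: "integrable M (X 1)"
proof (rule Bochner_Integration.integrable_bound[of M "\<lambda>\<omega>. 1 + \<bar>X 1 \<omega>\<bar> powr q"])
  have "\<bar>r\<bar> \<le> 1 + \<bar>r\<bar> powr q" for r :: real
    using q powr_mono[of 1 q "\<bar>r\<bar>"] by (cases "\<bar>r\<bar> \<ge> 1") (auto simp: add_increasing2)
  then show "AE \<omega> in M. norm (X 1 \<omega>) \<le> norm (1 + \<bar>X 1 \<omega>\<bar> powr q)"
    by (auto simp: add_nonneg_nonneg)
qed (use moment in auto)

text \<open>
  Since \<open>X 1\<close> has mean zero, the truncated mean is minus the mean of the part removed. On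
  \<open>{\<bar>X\<bar>\<^sup>q \<ge> n}\<close> one has \<open>\<bar>X\<bar> = \<bar>X\<bar>\<^sup>q (\<bar>X\<bar>\<^sup>q)\<^bsup>1/q-1\<^esup> \<le> \<bar>X\<bar>\<^sup>q n\<^bsup>1/q-1\<^esup>\<close>, as \<open>1/q - 1 \<le> 0\<close>.
\<close>

lemma drift_le:
  assumes n: "n > 0"
  shows "\<bar>expectation (\<lambda>\<omega>. if \<bar>X 1 \<omega>\<bar> powr q < n then X 1 \<omega> else 0)\<bar>
         \<le> n powr (1 / q - 1) * tail_moment M X q n"
proof -
  let ?W = "\<lambda>\<omega>. X 1 \<omega> * indicator {\<omega>. n \<le> \<bar>X 1 \<omega>\<bar> powr q} \<omega>"
  have int: "integrable M ?W"
    using integrable_X1 by (rule Bochner_Integration.integrable_bound) (auto simp: indicator_def)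
  have "expectation (\<lambda>\<omega>. if \<bar>X 1 \<omega>\<bar> powr q < n then X 1 \<omega> else 0) = expectation (\<lambda>\<omega>. X 1 \<omega> - ?W \<omega>)"
    by (intro Bochner_Integration.integral_cong) (auto simp: indicator_def)
  also have "\<dots> = - expectation ?W"
    using Bochner_Integration.integral_diff[OF integrable_X1 int] centered by simp
  finally have "\<bar>expectation (\<lambda>\<omega>. if \<bar>X 1 \<omega>\<bar> powr q < n then X 1 \<omega> else 0)\<bar> = \<bar>expectation ?W\<bar>"
    by simp
  also have "\<dots> \<le> expectation (\<lambda>\<omega>. \<bar>?W \<omega>\<bar>)"
    by (rule integral_abs_bound)
  also have "\<dots> \<le> expectation (\<lambda>\<omega>. n powr (1 / q - 1) *
      (\<bar>X 1 \<omega>\<bar> powr q * indicator {\<omega>. n \<le> \<bar>X 1 \<omega>\<bar> powr q} \<omega>))"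
  proof (rule integral_mono)
    fix \<omega>
    show "\<bar>?W \<omega>\<bar> \<le> n powr (1 / q - 1) *
      (\<bar>X 1 \<omega>\<bar> powr q * indicator {\<omega>. n \<le> \<bar>X 1 \<omega>\<bar> powr q} \<omega>)"
    proof (cases "n \<le> \<bar>X 1 \<omega>\<bar> powr q")
      case True
      then have pos: "\<bar>X 1 \<omega>\<bar> > 0" using n by (cases "X 1 \<omega> = 0") auto
      have "\<bar>X 1 \<omega>\<bar> = (\<bar>X 1 \<omega>\<bar> powr q) powr (1 / q - 1) * \<bar>X 1 \<omega>\<bar> powr q"
        using q pos by (simp add: powr_powr powr_add[symmetric] right_diff_distrib)
      also have "\<dots> \<le> n powr (1 / q - 1) * \<bar>X 1 \<omega>\<bar> powr q"
        using True n q by (intro mult_right_mono powr_mono2') (auto simp: field_simps)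
      finally show ?thesis using True by simp
    qed simp
  qed (use int integrable_tail in auto)
  also have "\<dots> = n powr (1 / q - 1) * tail_moment M X q n"
    unfolding tail_moment_def by simp
  finally show ?thesis .
qed

lemma prob_tail_le:
  assumes "i \<ge> 1"
  shows "prob {\<omega>\<in>space M. n \<le> \<bar>X i \<omega>\<bar> powr q} = prob {\<omega>\<in>space M. n \<le> \<bar>X 1 \<omega>\<bar> powr q}"
proof -
  have *: "prob {\<omega>\<in>space M. n \<le> \<bar>X i \<omega>\<bar> powr q} = measure (distr M borel (X i)) {r. n \<le> \<bar>r\<bar> powr q}"
    if "i \<ge> 1" for i
    using measurable_X[OF that] by (subst measure_distr) (auto intro!: arg_cong[where f = prob])
  have "distr M borel (X i) = distr M borel (X 1)"
    using iid assms unfolding iid_seq_def by blast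
  then show ?thesis
    unfolding *[OF assms] *[OF order_refl] by (simp only:)
qed

text \<open>
  With \<open>t = \<epsilon> n\<^bsup>1/q\<^esup>\<close>, a sum of size \<open>t\<close> needs a small part of size \<open>t/2\<close>, a middle part of size \<open>t/4\<close>
  or a summand with \<open>\<bar>X\<bar>\<^sup>q \<ge> n\<close>, because the hypothesis on the tail moment keeps the drift at
  most \<open>t/4\<close>. The three terms of the bound correspond to these three cases.
\<close>

lemma block_bound:
  fixes n :: nat and x \<epsilon> :: real
  assumes n: "n \<ge> 1" and x: "0 < x" "x \<le> real n" and \<epsilon>: "\<epsilon> > 0"
    and U: "2 * tail_moment M X q (real n) \<le> \<epsilon> / 4"
  shows "prob {\<omega>\<in>space M. \<exists>k\<in>{n..2*n}. \<epsilon> * real n powr (1 / q) \<le> \<bar>partial_sum X k \<omega>\<bar>}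
    \<le> 2 * exp (- (\<epsilon> * real n powr (1 / q))\<^sup>2 / (16 * real n * (x powr (1 / q))\<^sup>2))
      + 32 * real n / (\<epsilon> * real n powr (1 / q))\<^sup>2 *
          expectation (\<lambda>\<omega>. if x \<le> \<bar>X 1 \<omega>\<bar> powr q \<and> \<bar>X 1 \<omega>\<bar> powr q < real n then (X 1 \<omega>)\<^sup>2 else 0)
      + 2 * real n * prob {\<omega>\<in>space M. real n \<le> \<bar>X 1 \<omega>\<bar> powr q}"
proof -
  define t where "t = \<epsilon> * real n powr (1 / q)"
  have t: "t > 0" using n \<epsilon> by (simp add: t_def)
  define u v :: "real \<Rightarrow> real" where "u r = (if \<bar>r\<bar> powr q < x then r else 0)"
    and "v r = (if x \<le> \<bar>r\<bar> powr q \<and> \<bar>r\<bar> powr q < real n then r else 0)" for r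
  have [measurable]: "u \<in> borel_measurable borel" "v \<in> borel_measurable borel"
    unfolding u_def v_def by measurable
  have root: "\<bar>r\<bar> \<le> z powr (1 / q)" if "\<bar>r\<bar> powr q < z" for r z
    using that q powr_mono2[of "1 / q" "\<bar>r\<bar> powr q" z] by (auto simp: powr_powr)
  have u: "\<bar>u r\<bar> \<le> x powr (1 / q)" for r
    using root[of r x] by (auto simp: u_def)
  have v: "\<bar>v r\<bar> \<le> real n powr (1 / q)" for r
    using root[of r "real n"] by (auto simp: v_def)
  let ?a = "expectation (\<lambda>\<omega>. u (X 1 \<omega>))" and ?b = "expectation (\<lambda>\<omega>. v (X 1 \<omega>))"
  let ?Y = "\<lambda>i \<omega>. u (X i \<omega>) - ?a" and ?Z = "\<lambda>i \<omega>. v (X i \<omega>) - ?b"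
  interpret Y: bounded_centered_sequence M ?Y "2 * x powr (1 / q)"
    using u by (intro bounded_centered_sequence_truncation iid) auto
  interpret Z: bounded_centered_sequence M ?Z "2 * real n powr (1 / q)"
    using v by (intro bounded_centered_sequence_truncation iid) auto

  \<comment> \<open>The cut at \<open>x\<close> cancels from the sum of the two means, which is the mean of \<open>X 1\<close> truncated at
    the level \<open>n\<close> of the block.\<close>
  have drift: "\<bar>?a + ?b\<bar> \<le> real n powr (1 / q - 1) * tail_moment M X q (real n)"
  proof -
    have "?a + ?b = expectation (\<lambda>\<omega>. u (X 1 \<omega>) + v (X 1 \<omega>))"
    proof (rule Bochner_Integration.integral_add[symmetric])
      show "integrable M (\<lambda>\<omega>. u (X 1 \<omega>))"
        using u by (intro integrable_const_bound[where B = "x powr (1 / q)"]) auto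
      show "integrable M (\<lambda>\<omega>. v (X 1 \<omega>))"
        using v by (intro integrable_const_bound[where B = "real n powr (1 / q)"]) auto
    qed
    also have "\<dots> = expectation (\<lambda>\<omega>. if \<bar>X 1 \<omega>\<bar> powr q < real n then X 1 \<omega> else 0)"
      using x by (intro Bochner_Integration.integral_cong) (auto simp: u_def v_def)
    finally show ?thesis using drift_le[of "real n"] n by simp
  qed
  have drift_sum: "real k * \<bar>?a + ?b\<bar> \<le> t / 4" if "k \<le> 2 * n" for k
  proof -
    have "real k * \<bar>?a + ?b\<bar> \<le> real (2 * n) * (real n powr (1 / q - 1) * tail_moment M X q (real n))"
      using that drift by (intro mult_mono) auto
    also have "\<dots> = (real n * real n powr (1 / q - 1)) * (2 * tail_moment M X q (real n))"
      by simp
    also have "real n * real n powr (1 / q - 1) = real n powr (1 / q)"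
      using n by (simp add: powr_mult_base)
    also have "real n powr (1 / q) * (2 * tail_moment M X q (real n)) \<le> real n powr (1 / q) * (\<epsilon> / 4)"
      using U by (intro mult_left_mono) auto
    finally show ?thesis by (simp add: t_def mult.commute)
  qed

  let ?EY = "{\<omega>\<in>space M. \<exists>k\<in>{1..2*n}. t / 2 \<le> \<bar>partial_sum ?Y k \<omega>\<bar>}"
  let ?EZ = "{\<omega>\<in>space M. \<exists>k\<in>{1..2*n}. t / 4 \<le> \<bar>partial_sum ?Z k \<omega>\<bar>}"
  let ?EW = "\<Union>i\<in>{1..2*n}. {\<omega>\<in>space M. real n \<le> \<bar>X i \<omega>\<bar> powr q}"
  have W: "{\<omega>\<in>space M. real n \<le> \<bar>X i \<omega>\<bar> powr q} \<in> events" if "i \<ge> 1" for i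
    using measurable_X[OF that] by measurable
  have EY: "?EY \<in> events" and EZ: "?EZ \<in> events" by measurable
  have EW: "?EW \<in> events" by (intro sets.finite_UN W) auto
  have sub: "{\<omega>\<in>space M. \<exists>k\<in>{n..2*n}. t \<le> \<bar>partial_sum X k \<omega>\<bar>} \<subseteq> ?EY \<union> ?EZ \<union> ?EW"
  proof (rule subsetI, rule ccontr)
    fix \<omega>
    assume \<omega>: "\<omega> \<in> {\<omega>\<in>space M. \<exists>k\<in>{n..2*n}. t \<le> \<bar>partial_sum X k \<omega>\<bar>}"
      and no: "\<omega> \<notin> ?EY \<union> ?EZ \<union> ?EW"
    then obtain k where k: "n \<le> k" "k \<le> 2 * n" "t \<le> \<bar>partial_sum X k \<omega>\<bar>" by auto
    have small: "\<bar>X i \<omega>\<bar> powr q < real n" if "i \<in> {1..k}" for i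
      using no \<omega> that k by (auto simp: not_le)
    have "partial_sum X k \<omega> = (\<Sum>i=1..k. ?Y i \<omega> + ?Z i \<omega> + (?a + ?b))"
      unfolding partial_sum_def using small by (intro sum.cong refl) (fastforce simp: u_def v_def)
    also have "\<dots> = partial_sum ?Y k \<omega> + partial_sum ?Z k \<omega> + real k * (?a + ?b)"
      by (simp only: partial_sum_def sum.distrib sum_constant card_atLeastAtMost) (simp add: distrib_left)
    finally have "\<bar>partial_sum X k \<omega>\<bar> \<le>
        \<bar>partial_sum ?Y k \<omega>\<bar> + \<bar>partial_sum ?Z k \<omega>\<bar> + real k * \<bar>?a + ?b\<bar>"
      using abs_triangle_ineq[of "partial_sum ?Y k \<omega> + partial_sum ?Z k \<omega>" "real k * (?a + ?b)"]
        abs_triangle_ineq[of "partial_sum ?Y k \<omega>" "partial_sum ?Z k \<omega>"] by (simp add: abs_mult)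
    moreover have "\<bar>partial_sum ?Y k \<omega>\<bar> < t / 2" "\<bar>partial_sum ?Z k \<omega>\<bar> < t / 4"
      using no \<omega> k n by (auto simp: not_le)
    ultimately show False using drift_sum[OF k(2)] k(3) by linarith
  qed
  have "prob {\<omega>\<in>space M. \<exists>k\<in>{n..2*n}. t \<le> \<bar>partial_sum X k \<omega>\<bar>} \<le> prob (?EY \<union> ?EZ \<union> ?EW)"
    by (intro finite_measure_mono sub sets.Un EY EZ EW)
  also have "\<dots> \<le> prob (?EY \<union> ?EZ) + prob ?EW"
    by (intro measure_Un_le sets.Un EY EZ EW)
  also have "\<dots> \<le> prob ?EY + prob ?EZ + prob ?EW"
    by (intro add_right_mono measure_Un_le EY EZ)
  also have "prob ?EY \<le> 2 * exp (- (t / 2)\<^sup>2 / (2 * real (2 * n) * (x powr (1 / q))\<^sup>2))"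
  proof (rule Y.hoeffding_maximal[where a = "\<lambda>_. - ?a"])
    show "?Y i \<omega> \<in> {- ?a - x powr (1 / q)..- ?a + x powr (1 / q)}" for i \<omega>
      using u[of "X i \<omega>"] by auto
  qed (use x t n in auto)
  also have "- (t / 2)\<^sup>2 / (2 * real (2 * n) * (x powr (1 / q))\<^sup>2) = - t\<^sup>2 / (16 * real n * (x powr (1 / q))\<^sup>2)"
    by (simp add: power_divide)
  also have "prob ?EZ \<le> real (2 * n) * expectation (\<lambda>\<omega>. (v (X 1 \<omega>))\<^sup>2) / (t / 4)\<^sup>2"
  proof (rule Z.kolmogorov_maximal)
    show "expectation (\<lambda>\<omega>. (?Z i \<omega>)\<^sup>2) \<le> expectation (\<lambda>\<omega>. (v (X 1 \<omega>))\<^sup>2)" if "i \<ge> 1" for i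
      by (rule bounded_centered_sequence_truncation(2)[OF iid _ v that]) simp
  qed (use t in simp)
  also have "\<dots> = 32 * real n / t\<^sup>2 * expectation (\<lambda>\<omega>. (v (X 1 \<omega>))\<^sup>2)"
    by (simp add: power_divide)
  also have "prob ?EW \<le> (\<Sum>i=1..2*n. prob {\<omega>\<in>space M. real n \<le> \<bar>X i \<omega>\<bar> powr q})"
    using W by (intro finite_measure_subadditive_finite) auto
  also have "\<dots> = (\<Sum>i=1..2*n. prob {\<omega>\<in>space M. real n \<le> \<bar>X 1 \<omega>\<bar> powr q})"
    by (intro sum.cong refl prob_tail_le) auto
  also have "\<dots> = 2 * real n * prob {\<omega>\<in>space M. real n \<le> \<bar>X 1 \<omega>\<bar> powr q}"
    by simp
  also have "(\<lambda>\<omega>. (v (X 1 \<omega>))\<^sup>2) =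
      (\<lambda>\<omega>. if x \<le> \<bar>X 1 \<omega>\<bar> powr q \<and> \<bar>X 1 \<omega>\<bar> powr q < real n then (X 1 \<omega>)\<^sup>2 else 0)"
    by (auto simp: v_def)
  finally show ?thesis by (simp add: t_def)
qed

end

section \<open>Deviations beyond a time\<close>

text \<open>
  With \<open>\<mu> = m\<^bsup>1/q-1/2\<^esup>\<close> one has \<open>n\<^bsup>2/q\<^esup> = n \<mu>\<^sup>2 2\<^bsup>(2/q-1)i\<^esup>\<close>, whereas \<open>x\<^bsup>2/q\<^esup> \<le> \<mu> / (38 J\<^sup>2)\<close> because
  \<open>38\<^bsup>2/q\<^esup> \<ge> 38\<close>. The quotient is thus at least \<open>(38/16) \<mu> 2\<^bsup>(2/q-1)i\<^esup>\<close>; this is where the constant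
  \<open>38\<close> in the truncation level matters.
\<close>

lemma hoeffding_exponent_ge:
  fixes m i :: nat and q J :: real
  assumes m: "m \<ge> 1" and q: "1 \<le> q" "q < 2" and J: "J \<ge> 1"
  defines "n \<equiv> real (m * 2 ^ i)" and "x \<equiv> real m powr (1 / 2 - q / 4) / (38 * J powr q)"
  shows "2 * real m powr (1 / q - 1 / 2) * 2 powr ((2 / q - 1) * real i)
         \<le> (1 / J * n powr (1 / q))\<^sup>2 / (16 * n * (x powr (1 / q))\<^sup>2)"
proof -
  define \<mu> where "\<mu> = real m powr (1 / q - 1 / 2)"
  have n: "n > 0" using m by (simp add: n_def)
  have \<mu>: "\<mu> > 0" using m by (simp add: \<mu>_def)
  have square_powr: "(z powr (1 / q))\<^sup>2 = z powr (2 / q)" if "z > 0" for z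
    using that by (simp add: powr_powr powr_power)
  have x: "x > 0" using m J by (simp add: x_def)
  have "x powr (2 / q) = \<mu> / (38 powr (2 / q) * J\<^sup>2)"
  proof -
    have "(real m powr (1 / 2 - q / 4)) powr (2 / q) = \<mu>"
    proof -
      have "(1 / 2 - q / 4) * (2 / q) = 1 / q - 1 / 2" using q by (simp add: field_simps)
      then show ?thesis by (simp only: \<mu>_def powr_powr)
    qed
    moreover have "(J powr q) powr (2 / q) = J\<^sup>2"
      using q J by (simp add: powr_powr)
    ultimately show ?thesis
      using m J by (simp add: x_def powr_divide powr_mult)
  qed
  also have "\<dots> \<le> \<mu> / (38 * J\<^sup>2)"
  proof -
    have "38 powr 1 \<le> (38 :: real) powr (2 / q)" using q by (intro powr_mono) auto
    then show ?thesis using \<mu> J by (intro divide_left_mono mult_right_mono) auto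
  qed
  finally have xle: "x powr (2 / q) \<le> \<mu> / (38 * J\<^sup>2)" .
  have npow: "n powr (2 / q) = n * (\<mu>\<^sup>2 * 2 powr ((2 / q - 1) * real i))"
  proof -
    have "n powr (2 / q) = n powr (1 + (2 / q - 1))" by simp
    also have "\<dots> = n * n powr (2 / q - 1)"
      using n by (simp only: powr_add powr_one)
    also have "n powr (2 / q - 1) = real m powr (2 / q - 1) * (2 ^ i) powr (2 / q - 1)"
      by (simp add: n_def powr_mult)
    also have "(2 ^ i) powr (2 / q - 1) = 2 powr ((2 / q - 1) * real i)"
      by (simp add: powr_realpow[symmetric] powr_powr mult.commute)
    also have "real m powr (2 / q - 1) = \<mu>\<^sup>2"
      using m by (simp add: \<mu>_def powr_power algebra_simps)
    finally show ?thesis .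
  qed
  have "2 * \<mu> * 2 powr ((2 / q - 1) * real i) * (16 * n * x powr (2 / q))
      \<le> 2 * \<mu> * 2 powr ((2 / q - 1) * real i) * (16 * n * (\<mu> / (38 * J\<^sup>2)))"
    using xle \<mu> n by (intro mult_left_mono) auto
  also have "\<dots> = 32 / 38 * (n powr (2 / q) / J\<^sup>2)"
    unfolding npow using J by (simp add: field_simps power2_eq_square)
  also have "\<dots> \<le> n powr (2 / q) / J\<^sup>2"
    using mult_right_mono[of "32 / 38" 1 "n powr (2 / q) / J\<^sup>2"] by simp
  also have "\<dots> = (1 / J * n powr (1 / q))\<^sup>2"
    unfolding power_mult_distrib square_powr[OF n] by (simp add: power_divide)
  finally show ?thesis
    unfolding \<mu>_def[symmetric] square_powr[OF x] using n x by (simp add: pos_le_divide_eq)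
qed

text \<open>
  Put \<open>w = \<bar>r\<bar>\<^sup>q\<close> and \<open>y = 2/q - 1\<close>, so \<open>r\<^sup>2 = w\<^bsup>1+y\<^esup>\<close>. The second moments contribute
  \<open>32 J\<^sup>2 r\<^sup>2\<close> times the sum of \<open>n\<^bsup>-y\<^esup>\<close> over the scales \<open>n > w\<close>, at most \<open>96 q J\<^sup>2 w / (2-q)\<close>, and
  the union bounds contribute twice the sum of the scales \<open>n \<le> w\<close>, at most \<open>4w\<close>. As
  \<open>q J\<^sup>2 / (2-q) \<ge> 1\<close>, the total is at most \<open>100 q J\<^sup>2 w / (2-q)\<close>.
\<close>

lemma sum_moment_blocks_le:
  fixes m :: nat and q J x r :: real
  assumes m: "m \<ge> 1" and q: "1 \<le> q" "q < 2" and J: "J \<ge> 1" and x: "0 < x" "x \<le> real m"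
  defines "n \<equiv> \<lambda>i. real (m * 2 ^ i)"
  shows "(\<Sum>i<I. 32 * n i / (1 / J * n i powr (1 / q))\<^sup>2 *
              (if x \<le> \<bar>r\<bar> powr q \<and> \<bar>r\<bar> powr q < n i then r\<^sup>2 else 0)
            + 2 * n i * indicator {r. n i \<le> \<bar>r\<bar> powr q} r)
         \<le> 451 * q * J\<^sup>2 / (2 - q) * (\<bar>r\<bar> powr q * indicator {r. x \<le> \<bar>r\<bar> powr q} r)"
proof (cases "x \<le> \<bar>r\<bar> powr q")
  case False
  have "m \<le> m * 2 ^ i" for i by simp
  then have "real m \<le> n i" for i unfolding n_def by (simp only: of_nat_le_iff)
  then have "\<not> n i \<le> \<bar>r\<bar> powr q" for i using False x by (meson not_le order_trans)
  then show ?thesis using False by simp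
next
  case True
  define w y where "w = \<bar>r\<bar> powr q" and "y = 2 / q - 1"
  have w: "w > 0" using True x unfolding w_def by linarith
  have y: "y > 0" using q by (simp add: y_def field_simps)
  have n: "n i > 0" for i using m by (simp add: n_def)
  have ni: "n i = real m * 2 ^ i" for i by (simp add: n_def)
  have r: "r\<^sup>2 = w * w powr y"
  proof -
    have "r \<noteq> 0" using w by (auto simp: w_def)
    then have "w powr (1 + y) = \<bar>r\<bar>\<^sup>2"
      using q by (simp add: w_def y_def powr_powr)
    then show ?thesis using w by (simp add: powr_add)
  qed
  have coeff: "n i / (1 / J * n i powr (1 / q))\<^sup>2 = J\<^sup>2 * n i powr (- y)" for i
  proof -
    have "(1 / J * n i powr (1 / q))\<^sup>2 = n i powr (1 + y) / J\<^sup>2"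
      using n[of i] by (simp add: power_mult_distrib power_divide powr_power y_def)
    also have "n i powr (1 + y) = n i * n i powr y"
      using n[of i] by (simp add: powr_add)
    finally show ?thesis using n[of i] J by (simp add: powr_minus field_simps)
  qed
  have "(\<Sum>i<I. 32 * n i / (1 / J * n i powr (1 / q))\<^sup>2 * (if x \<le> w \<and> w < n i then r\<^sup>2 else 0)
            + 2 * n i * indicator {r. n i \<le> \<bar>r\<bar> powr q} r)
      = (\<Sum>i<I. 32 * J\<^sup>2 * r\<^sup>2 * (if w < n i then n i powr (- y) else 0)
            + 2 * (if n i \<le> w then n i else 0))"
    unfolding times_divide_eq_right[symmetric] coeff
    using True by (intro sum.cong refl) (auto simp: w_def indicator_def)
  also have "\<dots> = 32 * J\<^sup>2 * r\<^sup>2 * (\<Sum>i<I. if w < n i then n i powr (- y) else 0)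
            + 2 * (\<Sum>i<I. if n i \<le> w then n i else 0)"
    by (simp add: sum.distrib sum_distrib_left)
  also have "\<dots> \<le> 32 * J\<^sup>2 * r\<^sup>2 * (w powr (- y) * (3 * q / (2 - q))) + 2 * (2 * w)"
  proof (intro add_mono mult_left_mono)
    have "(\<Sum>i<I. if w < n i then n i powr (- y) else 0) \<le> w powr (- y) * (1 / (1 - 2 powr (- y)))"
      using sum_dyadic_powr_le[of "real m" w y I] m w y by (simp add: ni cong: if_cong)
    also have "\<dots> \<le> w powr (- y) * (3 * q / (2 - q))"
      unfolding y_def by (intro mult_left_mono inverse_one_minus_two_powr_le q) simp
    finally show "(\<Sum>i<I. if w < n i then n i powr (- y) else 0) \<le> w powr (- y) * (3 * q / (2 - q))" .
    show "(\<Sum>i<I. if n i \<le> w then n i else 0) \<le> 2 * w"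
      using sum_dyadic_le[of "real m" w I] w by (simp add: ni cong: if_cong)
  qed auto
  also have "\<dots> = 96 * (q * J\<^sup>2 / (2 - q)) * w + 4 * 1 * w"
  proof -
    have "r\<^sup>2 * w powr (- y) = w" using w by (simp add: r powr_minus)
    then have "32 * J\<^sup>2 * r\<^sup>2 * (w powr (- y) * (3 * q / (2 - q))) = 32 * J\<^sup>2 * w * (3 * q / (2 - q))"
      by (metis mult.assoc)
    then show ?thesis by simp
  qed
  also have "\<dots> \<le> 96 * (q * J\<^sup>2 / (2 - q)) * w + 4 * (q * J\<^sup>2 / (2 - q)) * w"
  proof -
    have "1 * 1 \<le> q * J\<^sup>2" using q J by (intro mult_mono) auto
    then have "1 \<le> q * J\<^sup>2 / (2 - q)" using q by (simp add: field_simps)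
    then show ?thesis using w by (intro add_left_mono mult_right_mono mult_left_mono) auto
  qed
  also have "\<dots> = 100 * (q * J\<^sup>2 / (2 - q) * w)" by simp
  also have "\<dots> \<le> 451 * (q * J\<^sup>2 / (2 - q) * w)"
    using q w by (intro mult_right_mono) auto
  finally show ?thesis using True by (simp add: w_def mult.assoc)
qed

text \<open>
  Every time \<open>k \<ge> m\<close> lies in a block from \<open>m 2\<^sup>i\<close> to \<open>m 2\<^bsup>i+1\<^esup>\<close>, so the block bounds add up.
  The moment terms are kept as integrals of \<open>H i (X 1)\<close> so that the sum over \<open>i\<close> can be moved under
  the integral and estimated pointwise.
\<close>

lemma (in centered_iid_sequence) maximal_deviation:
  fixes m :: nat and J :: real
  assumes m: "m \<ge> 1" and J: "J \<ge> 1"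
  defines "x \<equiv> real m powr (1 / 2 - q / 4) / (38 * J powr q)"
  assumes U: "2 * tail_moment M X q x \<le> 1 / J / 4"
  shows "emeasure M {\<omega>\<in>space M. \<exists>k\<ge>m. 1 / J \<le> \<bar>partial_sum X k \<omega>\<bar> / real k powr (1 / q)}
    \<le> ennreal (4 * exp (- (real m powr (1 / q - 1 / 2))) / (2 - q)
         + 451 * q * J\<^sup>2 / (2 - q) * tail_moment M X q x)"
proof -
  note [measurable] = measurable_X[OF order_refl]
  define n where "n i = m * 2 ^ i" for i
  have x: "x > 0" using m J by (simp add: x_def)
  have xm: "x \<le> real m"
  proof -
    have "x \<le> real m powr (1 / 2 - q / 4) / 1"
      unfolding x_def using q J ge_one_powr_ge_zero[of J q] by (intro divide_left_mono) auto
    also have "\<dots> \<le> real m powr 1"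
      unfolding div_by_1 using m q by (intro powr_mono) auto
    finally show ?thesis using m by simp
  qed
  have n: "n i \<ge> 1" "x \<le> real (n i)" for i
  proof -
    have "m \<le> n i" by (simp add: n_def)
    then show "n i \<ge> 1" "x \<le> real (n i)" using m xm by auto
  qed
  let ?A = "\<lambda>i. {\<omega>\<in>space M. \<exists>k\<in>{n i..2 * n i}. 1 / J * real (n i) powr (1 / q) \<le> \<bar>partial_sum X k \<omega>\<bar>}"
  let ?H = "\<lambda>i r. 32 * real (n i) / (1 / J * real (n i) powr (1 / q))\<^sup>2 *
              (if x \<le> \<bar>r\<bar> powr q \<and> \<bar>r\<bar> powr q < real (n i) then r\<^sup>2 else 0)
            + 2 * real (n i) * indicator {r. real (n i) \<le> \<bar>r\<bar> powr q} r"
  let ?e = "\<lambda>i. 2 * exp (- 2 * real m powr (1 / q - 1 / 2) * 2 powr ((2 / q - 1) * real i))"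
  have block: "emeasure M (?A i) \<le> ennreal (?e i) + (\<integral>\<^sup>+\<omega>. ennreal (?H i (X 1 \<omega>)) \<partial>M)" for i
  proof -
    let ?g = "\<lambda>r. if x \<le> \<bar>r\<bar> powr q \<and> \<bar>r\<bar> powr q < real (n i) then r\<^sup>2 else 0"
    have Un: "2 * tail_moment M X q (real (n i)) \<le> 1 / J / 4"
      using tail_moment_antimono[OF n(2), of i] U by linarith
    have g: "integrable M (\<lambda>\<omega>. ?g (X 1 \<omega>))"
    proof (rule integrable_const_bound[where B = "(real (n i) powr (1 / q))\<^sup>2"])
      have "\<bar>r\<bar> \<le> real (n i) powr (1 / q)" if "\<bar>r\<bar> powr q < real (n i)" for r
        using that q powr_mono2[of "1 / q" "\<bar>r\<bar> powr q" "real (n i)"] by (auto simp: powr_powr)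
      then have "\<bar>?g r\<bar> \<le> (real (n i) powr (1 / q))\<^sup>2" for r
        using power_mono[of "\<bar>r\<bar>" "real (n i) powr (1 / q)" 2] by auto
      then show "AE \<omega> in M. norm (?g (X 1 \<omega>)) \<le> (real (n i) powr (1 / q))\<^sup>2"
        by (intro AE_I2) (simp only: real_norm_def)
    qed measurable
    have tail: "integrable M (\<lambda>\<omega>. indicator {r. real (n i) \<le> \<bar>r\<bar> powr q} (X 1 \<omega>) :: real)"
      by (rule integrable_const_bound[where B = 1]) auto
    have tail_eq: "expectation (\<lambda>\<omega>. indicator {r. real (n i) \<le> \<bar>r\<bar> powr q} (X 1 \<omega>))
        = prob {\<omega>\<in>space M. real (n i) \<le> \<bar>X 1 \<omega>\<bar> powr q}"
    proof -
      have "expectation (\<lambda>\<omega>. indicator {r. real (n i) \<le> \<bar>r\<bar> powr q} (X 1 \<omega>) :: real)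
        = expectation (indicator {\<omega>\<in>space M. real (n i) \<le> \<bar>X 1 \<omega>\<bar> powr q})"
        by (intro Bochner_Integration.integral_cong) (auto simp: indicator_def)
      then show ?thesis by simp
    qed
    have H: "integrable M (\<lambda>\<omega>. ?H i (X 1 \<omega>))"
      by (intro Bochner_Integration.integrable_add integrable_mult_right g tail)
    have H_eq: "expectation (\<lambda>\<omega>. ?H i (X 1 \<omega>)) = 32 * real (n i) / (1 / J * real (n i) powr (1 / q))\<^sup>2 *
          expectation (\<lambda>\<omega>. ?g (X 1 \<omega>)) + 2 * real (n i) * prob {\<omega>\<in>space M. real (n i) \<le> \<bar>X 1 \<omega>\<bar> powr q}"
      by (simp only: Bochner_Integration.integral_add[OF integrable_mult_right[OF g] integrable_mult_right[OF tail]]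
          integral_mult_right_zero tail_eq)
    have "- (1 / J * real (n i) powr (1 / q))\<^sup>2 / (16 * real (n i) * (x powr (1 / q))\<^sup>2)
        \<le> - 2 * real m powr (1 / q - 1 / 2) * 2 powr ((2 / q - 1) * real i)"
      using hoeffding_exponent_ge[OF m q J, of i] by (simp add: n_def x_def)
    then have "prob (?A i) \<le> ?e i + expectation (\<lambda>\<omega>. ?H i (X 1 \<omega>))"
      using block_bound[OF n(1) x n(2) _ Un] J unfolding H_eq by (smt (verit) divide_pos_pos exp_le_cancel_iff)
    then have "emeasure M (?A i) \<le> ennreal (?e i + expectation (\<lambda>\<omega>. ?H i (X 1 \<omega>)))"
      unfolding emeasure_eq_measure by (rule ennreal_leI)
    also have "\<dots> = ennreal (?e i) + ennreal (expectation (\<lambda>\<omega>. ?H i (X 1 \<omega>)))"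
      by (intro ennreal_plus integral_nonneg_AE) auto
    also have "ennreal (expectation (\<lambda>\<omega>. ?H i (X 1 \<omega>))) = (\<integral>\<^sup>+\<omega>. ennreal (?H i (X 1 \<omega>)) \<partial>M)"
      by (intro nn_integral_eq_integral[symmetric] H) auto
    finally show ?thesis .
  qed

  have cover: "{\<omega>\<in>space M. \<exists>k\<ge>m. 1 / J \<le> \<bar>partial_sum X k \<omega>\<bar> / real k powr (1 / q)} \<subseteq> (\<Union>i. ?A i)"
  proof safe
    fix \<omega> k
    assume \<omega>: "\<omega> \<in> space M" and k: "m \<le> k" and dev: "1 / J \<le> \<bar>partial_sum X k \<omega>\<bar> / real k powr (1 / q)"
    have "\<exists>i. k < m * 2 ^ i"
    proof
      have "k < 2 ^ k" by (rule less_exp)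
      also have "2 ^ k \<le> m * 2 ^ k" using m by simp
      finally show "k < m * 2 ^ k" .
    qed
    then obtain i where i: "k < m * 2 ^ Suc i" "m * 2 ^ i \<le> k"
      using exists_least_lemma[of "\<lambda>i. k < m * 2 ^ i"] k by (auto simp: not_less)
    have "1 / J * real (n i) powr (1 / q) \<le> 1 / J * real k powr (1 / q)"
    proof (intro mult_left_mono powr_mono2)
      show "real (n i) \<le> real k" using i(2) unfolding n_def of_nat_le_iff .
    qed (use q J in auto)
    also have "\<dots> \<le> \<bar>partial_sum X k \<omega>\<bar>"
      using dev k m by (simp add: pos_le_divide_eq)
    finally show "\<omega> \<in> (\<Union>i. ?A i)"
      using \<omega> i by (auto simp: n_def intro!: exI[of _ i] bexI[of _ k])
  qed
  have "emeasure M {\<omega>\<in>space M. \<exists>k\<ge>m. 1 / J \<le> \<bar>partial_sum X k \<omega>\<bar> / real k powr (1 / q)}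
      \<le> emeasure M (\<Union>i. ?A i)"
    by (intro emeasure_mono cover) measurable
  also have "\<dots> \<le> (\<Sum>i. emeasure M (?A i))"
    by (intro emeasure_subadditive_countably) (auto simp: image_subset_iff)
  also have "\<dots> \<le> (\<Sum>i. ennreal (?e i) + (\<integral>\<^sup>+\<omega>. ennreal (?H i (X 1 \<omega>)) \<partial>M))"
    by (intro suminf_le block summableI)
  also have "\<dots> = (\<Sum>i. ennreal (?e i)) + (\<Sum>i. \<integral>\<^sup>+\<omega>. ennreal (?H i (X 1 \<omega>)) \<partial>M)"
    by (intro suminf_add[symmetric] summableI)
  also have "(\<Sum>i. ennreal (?e i)) \<le> ennreal (4 * exp (- (real m powr (1 / q - 1 / 2))) / (2 - q))"
  proof (rule suminf_le_const[OF summableI])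
    fix I
    have \<mu>: "1 \<le> real m powr (1 / q - 1 / 2)"
      using m q by (intro ge_one_powr_ge_zero) (auto simp: field_simps)
    have "(\<Sum>i<I. ennreal (?e i)) = ennreal (\<Sum>i<I. ?e i)"
      by (intro sum_ennreal) auto
    also have "\<dots> \<le> ennreal (4 * exp (- (real m powr (1 / q - 1 / 2))) / (2 - q))"
      by (intro ennreal_leI sum_exp_dyadic_le q \<mu>)
    finally show "(\<Sum>i<I. ennreal (?e i)) \<le> ennreal (4 * exp (- (real m powr (1 / q - 1 / 2))) / (2 - q))" .
  qed
  also have "(\<Sum>i. \<integral>\<^sup>+\<omega>. ennreal (?H i (X 1 \<omega>)) \<partial>M) = (\<integral>\<^sup>+\<omega>. (\<Sum>i. ennreal (?H i (X 1 \<omega>))) \<partial>M)"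
    by (intro nn_integral_suminf[symmetric]) measurable
  also have "\<dots> \<le> (\<integral>\<^sup>+\<omega>. ennreal (451 * q * J\<^sup>2 / (2 - q) *
      (\<bar>X 1 \<omega>\<bar> powr q * indicator {\<omega>. x \<le> \<bar>X 1 \<omega>\<bar> powr q} \<omega>)) \<partial>M)"
  proof (intro nn_integral_mono suminf_le_const[OF summableI])
    fix \<omega> I
    have "(\<Sum>i<I. ennreal (?H i (X 1 \<omega>))) = ennreal (\<Sum>i<I. ?H i (X 1 \<omega>))"
      by (intro sum_ennreal) auto
    also have "\<dots> \<le> ennreal (451 * q * J\<^sup>2 / (2 - q) *
      (\<bar>X 1 \<omega>\<bar> powr q * indicator {r. x \<le> \<bar>r\<bar> powr q} (X 1 \<omega>)))"
      unfolding n_def by (intro ennreal_leI sum_moment_blocks_le m q J x xm)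
    finally show "(\<Sum>i<I. ennreal (?H i (X 1 \<omega>))) \<le> ennreal (451 * q * J\<^sup>2 / (2 - q) *
      (\<bar>X 1 \<omega>\<bar> powr q * indicator {\<omega>. x \<le> \<bar>X 1 \<omega>\<bar> powr q} \<omega>))"
      by (simp add: indicator_def)
  qed
  also have "\<dots> = ennreal (expectation (\<lambda>\<omega>. 451 * q * J\<^sup>2 / (2 - q) *
      (\<bar>X 1 \<omega>\<bar> powr q * indicator {\<omega>. x \<le> \<bar>X 1 \<omega>\<bar> powr q} \<omega>)))"
    using q by (intro nn_integral_eq_integral integrable_mult_right integrable_tail) auto
  also have "\<dots> = ennreal (451 * q * J\<^sup>2 / (2 - q) * tail_moment M X q x)"
    by (simp add: tail_moment_def)
  also have "ennreal (4 * exp (- (real m powr (1 / q - 1 / 2))) / (2 - q)) + \<dots>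
      = ennreal (4 * exp (- (real m powr (1 / q - 1 / 2))) / (2 - q)
         + 451 * q * J\<^sup>2 / (2 - q) * tail_moment M X q x)"
    using q tail_moment_nonneg by (intro ennreal_plus[symmetric]) auto
  finally show ?thesis by (simp add: add_mono)
qed

section \<open>The e-process\<close>

context centered_iid_sequence
begin

abbreviation deviation :: "nat \<Rightarrow> nat \<Rightarrow> 'a \<Rightarrow> bool" where
  "deviation j k \<omega> \<equiv> 1 / real j \<le> \<bar>partial_sum X k \<omega>\<bar> / real k powr (1 / q)"

text \<open>
  The threshold condition is used twice: it is the bound itself, and as its right hand side is at
  most one it yields \<open>8 j U \<le> 1\<close>, the smallness of the tail moment that the drift estimate
  requires.
\<close>

lemma emeasure_deviation_le:
  assumes j: "j \<ge> 1"
  shows "emeasure M {\<omega>\<in>space M. \<exists>k\<ge>threshold M X q j. deviation j k \<omega>} \<le> ennreal (1 / 2 ^ j)"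
proof -
  define m where "m = threshold M X q j"
  define x where "x = real m powr (1 / 2 - q / 4) / (38 * real j powr q)"
  have m: "m \<ge> 1" and cond: "threshold_cond M X q j m"
    unfolding m_def using threshold[where X = X, OF measurable_X[OF order_refl] moment q j] by auto
  have J: "real j \<ge> 1" using j by simp
  have bound: "4 * exp (- (real m powr (1 / q - 1 / 2))) / (2 - q)
      + 451 * q * (real j)\<^sup>2 / (2 - q) * tail_moment M X q x \<le> 1 / 2 ^ j"
    using cond by (simp add: threshold_cond_def x_def)
  have "2 * tail_moment M X q x \<le> 1 / real j / 4"
  proof -
    let ?U = "tail_moment M X q x"
    have "1 / 2 ^ j \<le> (1 :: real)" by simp
    moreover have "0 \<le> 4 * exp (- (real m powr (1 / q - 1 / 2))) / (2 - q)"
      using q by simp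
    ultimately have "451 * q * (real j)\<^sup>2 / (2 - q) * ?U \<le> 1"
      using bound by linarith
    moreover have "8 * real j * ?U \<le> 451 * q * (real j)\<^sup>2 / (2 - q) * ?U"
    proof (rule mult_right_mono[OF _ tail_moment_nonneg])
      have "8 * real j \<le> 451 * (q * (real j)\<^sup>2)"
      proof -
        have "1 * (real j * 1) \<le> q * (real j * real j)" using q J by (intro mult_mono) auto
        then show ?thesis by (simp add: power2_eq_square)
      qed
      also have "\<dots> \<le> 451 * (q * (real j)\<^sup>2) / (2 - q)"
        using q mult_left_mono[of "2 - q" 1 "451 * (q * (real j)\<^sup>2)"] by (simp add: pos_le_divide_eq)
      finally show "8 * real j \<le> 451 * q * (real j)\<^sup>2 / (2 - q)" by (simp add: mult.assoc)
    qed
    ultimately have "8 * real j * ?U \<le> 1" by linarith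
    then show ?thesis using J by (simp add: field_simps)
  qed
  from maximal_deviation[OF m J this[unfolded x_def]]
  show ?thesis
    unfolding m_def[symmetric] x_def[symmetric] by (rule order_trans) (intro ennreal_leI bound)
qed

lemma finite_threshold: "finite {j. 1 \<le> j \<and> threshold M X q j \<le> n}"
proof -
  have "{j. 1 \<le> j \<and> threshold M X q j \<le> n} = {j \<in> {1..}. threshold M X q j \<le> n}" by auto
  then show ?thesis
    using finite_threshold_le[where X = X, OF measurable_X[OF order_refl] moment q] by (simp only:)
qed

lemma slln_e_process_eq_sum:
  "slln_e_process M X q n \<omega> =
     (\<Sum>j | 1 \<le> j \<and> threshold M X q j \<le> n.
        indicator {\<omega>. \<exists>k\<in>{threshold M X q j..n}. deviation j k \<omega>} \<omega>)"
proof -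
  let ?f = "\<lambda>j. indicator {\<omega>. \<exists>k\<in>{threshold M X q j..n}. deviation j k \<omega>} \<omega> :: ennreal"
  let ?J = "{j. 1 \<le> j \<and> threshold M X q j \<le> n}"
  have "slln_e_process M X q n \<omega> = infsum ?f ?J"
    unfolding slln_e_process_def by (rule infsum_cong_neutral) (auto simp: indicator_def)
  also have "\<dots> = sum ?f ?J"
    by (intro infsum_finite finite_threshold)
  finally show ?thesis .
qed

text \<open>
  Only finitely many indices contribute at time \<open>n\<close>, and each contribution is an event about
  \<open>S\<^sub>1, \<dots>, S\<^sub>n\<close>.
\<close>

lemma slln_e_process_adapted: "slln_e_process M X q n \<in> borel_measurable (natural_filtration M X n)"
proof -
  let ?F = "natural_filtration M X n"
  let ?G = "{X i -` B \<inter> space M | i B. i \<in> {1..n} \<and> B \<in> sets borel}"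
  have G: "?G \<subseteq> Pow (space M)" by auto
  have X: "X i \<in> borel_measurable ?F" if "i \<in> {1..n}" for i
  proof (rule measurableI)
    fix B :: "real set" assume "B \<in> sets borel"
    with that have "X i -` B \<inter> space M \<in> ?G" by blast
    then show "X i -` B \<inter> space ?F \<in> sets ?F"
      unfolding natural_filtration_def space_measure_of[OF G] sets_measure_of[OF G]
      by (rule sigma_sets.Basic)
  qed simp
  have S: "partial_sum X k \<in> borel_measurable ?F" if "k \<le> n" for k
    unfolding partial_sum_def[abs_def] using that by (intro borel_measurable_sum X) auto
  have "{\<omega> \<in> space ?F. \<exists>k\<in>{l..n}. deviation j k \<omega>} \<in> sets ?F" for j l
  proof -
    have "{\<omega> \<in> space ?F. \<exists>k\<in>{l..n}. deviation j k \<omega>} =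
        (\<Union>k\<in>{l..n}. {\<omega> \<in> space ?F. deviation j k \<omega>})" by auto
    also have "\<dots> \<in> sets ?F"
    proof (intro sets.finite_UN)
      fix k assume "k \<in> {l..n}"
      then have [measurable]: "partial_sum X k \<in> borel_measurable ?F" by (intro S) simp
      show "{\<omega> \<in> space ?F. deviation j k \<omega>} \<in> sets ?F" by measurable
    qed simp
    finally show ?thesis .
  qed
  then have "(\<lambda>\<omega>. indicator {\<omega>. \<exists>k\<in>{l..n}. deviation j k \<omega>} \<omega> :: ennreal) \<in> borel_measurable ?F" for j l
    by (intro borel_measurable_indicator') (simp only: mem_Collect_eq)
  then have "(\<lambda>\<omega>. \<Sum>j | 1 \<le> j \<and> threshold M X q j \<le> n.
      indicator {\<omega>. \<exists>k\<in>{threshold M X q j..n}. deviation j k \<omega>} \<omega> :: ennreal) \<in> borel_measurable ?F"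
    by (rule borel_measurable_sum)
  moreover have "slln_e_process M X q n = (\<lambda>\<omega>. \<Sum>j | 1 \<le> j \<and> threshold M X q j \<le> n.
      indicator {\<omega>. \<exists>k\<in>{threshold M X q j..n}. deviation j k \<omega>} \<omega>)"
    by (rule ext) (rule slln_e_process_eq_sum)
  ultimately show ?thesis by (simp only:)
qed

text \<open>
  The bound by the full sum of indicators holds at all times and for the limit superior,
  so it holds for every stopped value, even though \<open>\<tau>\<close> may be infinite.
\<close>

lemma e_process_slln: "e_process M (natural_filtration M X) (slln_e_process M X q)"
  unfolding e_process_def
proof (intro conjI allI impI slln_e_process_adapted)
  fix \<tau> :: "'a \<Rightarrow> enat"
  let ?A = "\<lambda>i. {\<omega>\<in>space M. \<exists>k\<ge>threshold M X q (Suc i). deviation (Suc i) k \<omega>}"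
  have A: "?A i \<in> events" for i by measurable
  define S where "S \<omega> = (\<Sum>i. indicator (?A i) \<omega> :: ennreal)" for \<omega>
  have le: "slln_e_process M X q n \<omega> \<le> S \<omega>" if "\<omega> \<in> space M" for n \<omega>
  proof -
    let ?J = "{j. 1 \<le> j \<and> threshold M X q j \<le> n}"
    have "slln_e_process M X q n \<omega> \<le> (\<Sum>j\<in>?J. indicator (?A (j - 1)) \<omega>)"
      unfolding slln_e_process_eq_sum using that by (intro sum_mono) (auto simp: indicator_def)
    also have "\<dots> = (\<Sum>i\<in>(\<lambda>j. j - 1) ` ?J. indicator (?A i) \<omega>)"
      by (subst sum.reindex) (auto simp: inj_on_def)
    also have "\<dots> \<le> S \<omega>"
      unfolding S_def by (intro sum_le_suminf summableI finite_imageI finite_threshold) auto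
    finally show ?thesis .
  qed
  have "stopped_value (slln_e_process M X q) \<tau> \<omega> \<le> S \<omega>" if "\<omega> \<in> space M" for \<omega>
    unfolding stopped_value_def using le[OF that]
    by (auto split: enat.split intro!: Limsup_bounded)
  then have "(\<integral>\<^sup>+\<omega>. stopped_value (slln_e_process M X q) \<tau> \<omega> \<partial>M) \<le> (\<integral>\<^sup>+\<omega>. S \<omega> \<partial>M)"
    by (rule nn_integral_mono)
  also have "\<dots> = (\<Sum>i. emeasure M (?A i))"
    unfolding S_def
    by (simp only: nn_integral_suminf[OF borel_measurable_indicator[OF A]] nn_integral_indicator[OF A])
  also have "\<dots> \<le> (\<Sum>i. ennreal ((1 / 2) ^ Suc i))"
  proof (intro suminf_le summableI)
    show "emeasure M (?A i) \<le> ennreal ((1 / 2) ^ Suc i)" for i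
      unfolding power_one_over by (rule emeasure_deviation_le) simp
  qed
  also have "\<dots> = ennreal 1"
    by (intro suminf_ennreal_eq power_half_series) simp
  finally show "(\<integral>\<^sup>+\<omega>. stopped_value (slln_e_process M X q) \<tau> \<omega> \<partial>M) \<le> 1" by simp
qed

lemma slln_e_process_diverges:
  assumes "\<not> (\<lambda>n. partial_sum X n \<omega> / real n powr (1 / q)) \<longlonglongrightarrow> 0"
  shows "(\<lambda>n. slln_e_process M X q n \<omega>) \<longlonglongrightarrow> \<infinity>"
proof -
  obtain r where r: "r > 0" and freq: "\<And>N. \<exists>k\<ge>N. r \<le> \<bar>partial_sum X k \<omega>\<bar> / real k powr (1 / q)"
    using assms unfolding LIMSEQ_iff by (auto simp: not_less abs_mult)
  obtain j0 where j0: "1 / real (Suc j0) < r" using reals_Archimedean[OF r] by (auto simp: inverse_eq_divide)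
  have ev: "\<forall>\<^sub>F n in sequentially. of_nat L \<le> slln_e_process M X q n \<omega>" for L
  proof -
    let ?L = "{Suc j0..<Suc j0 + L}"
    have "\<exists>k\<ge>threshold M X q j. deviation j k \<omega>" if "j \<in> ?L" for j
    proof -
      have "1 / real j \<le> 1 / real (Suc j0)" using that by (intro divide_left_mono) auto
      then show ?thesis using freq[of "threshold M X q j"] j0 by (meson less_le_trans less_imp_le order_trans)
    qed
    then have "\<forall>j\<in>?L. \<exists>k. threshold M X q j \<le> k \<and> deviation j k \<omega>" by blast
    from bchoice[OF this] obtain k
      where k: "\<And>j. j \<in> ?L \<Longrightarrow> threshold M X q j \<le> k j \<and> deviation j (k j) \<omega>" by blast
    show ?thesis
    proof (rule eventually_sequentiallyI)
      fix n assume n: "Max (insert 0 (k ` ?L)) \<le> n"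
      have kn: "k j \<le> n" if "j \<in> ?L" for j
        using n that by auto
      have "of_nat L = (\<Sum>j\<in>?L. 1 :: ennreal)" by simp
      also have "\<dots> = (\<Sum>j\<in>?L. indicator {\<omega>. \<exists>k\<in>{threshold M X q j..n}. deviation j k \<omega>} \<omega>)"
      proof (intro sum.cong refl)
        fix j assume "j \<in> ?L"
        then have "\<exists>k\<in>{threshold M X q j..n}. deviation j k \<omega>"
          by (intro bexI[of _ "k j"]) (use k kn in auto)
        then show "1 = (indicator {\<omega>. \<exists>k\<in>{threshold M X q j..n}. deviation j k \<omega>} \<omega> :: ennreal)"
          unfolding indicator_def mem_Collect_eq by simp
      qed
      also have "\<dots> \<le> slln_e_process M X q n \<omega>"
        unfolding slln_e_process_eq_sum
      proof (intro sum_mono2 finite_threshold)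
        show "?L \<subseteq> {j. 1 \<le> j \<and> threshold M X q j \<le> n}"
        proof
          fix j assume j: "j \<in> ?L"
          have "threshold M X q j \<le> n" using k[OF j] kn[OF j] by linarith
          then show "j \<in> {j. 1 \<le> j \<and> threshold M X q j \<le> n}" using j by simp
        qed
      qed simp
      finally show "of_nat L \<le> slln_e_process M X q n \<omega>" .
    qed
  qed
  show ?thesis
    unfolding infinity_ennreal_def tendsto_top_iff_ennreal
  proof (intro allI impI)
    fix l :: real assume "0 \<le> l"
    obtain L :: nat where L: "l < real L" using reals_Archimedean2 by blast
    have "ennreal l < of_nat L" using L \<open>0 \<le> l\<close> by (simp add: ennreal_of_nat_eq_real_of_nat ennreal_less_iff)
    then show "\<forall>\<^sub>F n in sequentially. ennreal l < slln_e_process M X q n \<omega>"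
      using ev[of L] by (auto elim!: eventually_mono)
  qed
qed

end

theorem mainTheorem11:
  fixes M :: "'a measure" and X :: "nat \<Rightarrow> 'a \<Rightarrow> real" and q :: real
  assumes "prob_space M"
    and "iid_seq M X"
    and "1 \<le> q" and "q < 2"
    and "integrable M (\<lambda>\<omega>. \<bar>X 1 \<omega>\<bar> powr q)"
    and "(\<integral>\<omega>. X 1 \<omega> \<partial>M) = 0"
  shows "e_process M (natural_filtration M X) (slln_e_process M X q) \<and>
         (\<forall>\<omega>\<in>space M. \<not> (\<lambda>n. partial_sum X n \<omega> / real n powr (1 / q)) \<longlonglongrightarrow> 0 \<longrightarrow>
           (\<lambda>n. slln_e_process M X q n \<omega>) \<longlonglongrightarrow> \<infinity>)"
proof -
  interpret prob_space M by fact
  interpret centered_iid_sequence M X q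
    by unfold_locales (use assms in auto)
  show ?thesis
    using e_process_slln slln_e_process_diverges by blast
qed

end
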